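(* Suppose that the first-stage variables are binary, i.e. $\mathcal X^{\mathrm{MIO}}=\{0,1\}^{n_Z}$, and that Problem $(\star)$ has relatively complete recourse. Then the DD&ILS algorithm (double decomposition with integer L-shaped cuts, defined in the context) converges in a finite number of iterations to an optimal solution of Problem $(\star)$.
   Context: **Problem $(\star)$.** Let $\mathcal S$ be a set of scenarios, scenario $s$ having probability $\pi_s$, and let the first-stage indices be partitioned into sets $\mathcal K_j$, $j\in\mathcal J$. The first-stage vector $x$ satisfies $Ax\ge b$ and $x\in\mathcal X^{\mathrm{MIO}}$ (in general a mixed-integer region). For each $s\in\mathcal S$, $j\in\mathcal J$ there is a network with node set $\mathcal N_{sj}$ and arc set $\mathcal A_{sj}$; there are second-stage variables $y_a\in\mathcal Y^{\mathrm{MIO}}_a$ for $a\in\mathcal A_{sj}$ (the sets $\mathcal Y^{\mathrm{MIO}}_a$ encode discrete requirements), costs $g_a$, scalars $b_{nsk}$, and vectors $f_{a,s,j}$ and $h_{sj}$. Problem $(\star)$ is $$\min\ \sum_{j\in\mathcal J}\sum_{k\in\mathcal K_j}c_kx_k+\sum_{s\in\mathcal S}\sum_{j\in\mathcal J}\pi_s\sum_{a\in\mathcal A_{sj}}g_ay_a$$ subject to $Ax\ge b$, $x\in\mathcal X^{\mathrm{MIO}}$, $y_a\in\mathcal Y_a^{\mathrm{MIO}}$ and, for all $s,j$, (FB) $\sum_{m:(n,m)\in\mathcal A_{sj}}y_{(n,m)}-\sum_{m:(m,n)\in\mathcal A_{sj}}y_{(m,n)}=\sum_{k\in\mathcal K_j}b_{nsk}x_k$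 for all $n\in\mathcal N_{sj}$; (SC) $\sum_{a\in\mathcal A_{sj}}f_{a,s,j}\,y_a\ge h_{sj}$. **Second stage.** For fixed $x$, $\varphi_{sj}(x)$ is the minimum of $\sum_{a\in\mathcal A_{sj}} g_ay_a$ subject to (FB), (SC), $y_a\in\mathcal Y^{\mathrm{MIO}}_a$; the Benders subproblem for $(s,j)$ is the same problem with $y\ge0$ in place of $y_a\in\mathcal Y^{\mathrm{MIO}}_a$. *Relatively complete recourse* means that the second-stage problem (with integrality requirements) is feasible for every feasible first-stage solution $x$. The dual of the Benders subproblem maximizes $\sum_{n\in\mathcal N_{sj}}\sum_{k\in\mathcal K_j}b_{nsk}x_k\psi_{sjn}+h_{sj}^\top\gamma_{sj}$ over $$\mathcal P_{sj}=\{(\psi_{sj},\gamma_{sj}):\gamma_{sj}\ge0,\ \psi_{sjm}-\psi_{sjn}+\gamma_{sj}^\top f_{(m,n),s,j}\le g_{(m,n)}\ \forall(m,n)\in\mathcal A_{sj}\},$$ whose extreme points are indexed as $\{(\psi^u_{sj},\gamma^u_{sj}):u\in\mathcal U_{sj}\}$. Let $\underline\Phi_{sj}$ denote a global lower bound of the second-stage cost $\varphi_{sj}(x)$. **DD&ILS algorithm.** Maintain subsets $\mathcal U^0_{sj}\subseteq\mathcal U_{sj}$ and a list $\{\widehat x^w:w\in\mathcal W^0\}$ of visited first-stage solutions; fix a small tolerance $\varepsilon>0$. (1) Solve the master problem: minimize $\sum_j\sum_{k\in\mathcal K_j}c_kx_k+\sum_{s,j}\pi_s\theta_{sj}$ subject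 to $Ax\ge b$, $x\in\mathcal X^{\mathrm{MIO}}$, the Benders optimality cuts $$\theta_{sj}\ge\sum_{n\in\mathcal N_{sj}}\sum_{k\in\mathcal K_j}b_{nsk}x_k\psi^u_{sjn}+h_{sj}^\top\gamma^u_{sj}\quad\forall s,j,\ u\in\mathcal U^0_{sj},$$ and the integer L-shaped cuts $$\theta_{sj}\ge\underline\Phi_{sj}+\big(\varphi_{sj}(\widehat x^w)-\underline\Phi_{sj}\big)\Big(1-\sum_{k\in\mathcal K_j:\widehat x^w_k=1}(1-x_k)-\sum_{k\in\mathcal K_j:\widehat x^w_k=0}x_k\Big)\quad\forall s,j,\ w\in\mathcal W^0 .$$ If it is infeasible, terminate (problem infeasible); otherwise let $(\widehat x,\widehat\theta)$ be its solution. (2) Solve the Benders subproblems at $\widehat x$ by column generation: solve them with restricted arc sets $\mathcal A'_{sj}\subseteq\mathcal A_{sj}$ in place of $\mathcal A_{sj}$, with dual solution $(\psi,\gamma)$; compute for each $s,j$ the value $RC=\min\{g_{(m,n)}-(\psi_{sjm}-\psi_{sjn})-\gamma_{sj}^\top f_{(m,n),s,j}:(m,n)\in\mathcal A_{sj}\}$; if $RC<0$ add the corresponding arc to $\mathcal A'_{sj}$ and repeat, and stop when $RC\ge0$ for all $s,j$. If the Benders optimality cuts given by the optimal dual extreme points are violated by $(\widehat x,\widehat\theta)$, add them (expanding $\mathcal U^0_{sj}$) and return to (1). (3) Otherwise solve the second-stage problem with integrality requirements at $\widehat x$, giving $\varphi_{sj}(\widehat x)$ for all $s,j$, and let $\mathrm{GAP}=\sum_{s}\pi_s\sum_j(\varphi_{sj}(\widehat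 x)-\widehat\theta_{sj})$. If $\mathrm{GAP}<\varepsilon$, terminate and return $\widehat x$ (with its second-stage solution) as the optimal solution of $(\star)$. If $\mathrm{GAP}\ge\varepsilon$, add $\widehat x$ to the list indexed by $\mathcal W^0$, i.e. add the corresponding integer L-shaped cuts, and return to (1).
   Formalization: Exact optimality for ε below an instance-dependent bound (ε-optimality for all ε); extreme points taken modulo lineality; P_sj assumed nonempty, Y_a within [0,∞), initial master bounded below with visited points feasible, initial restricted subproblems feasible. *)

theory Defs
  imports "HOL-Analysis.Analysis"
begin

text \<open>
  Scenarios, blocks of first-stage indices, first-stage indices, first-stage rows, nodes and
  side-constraint rows are elements of finite types. The networks of the pairs \<open>(s, j)\<close> are
  subsets of the node type; second-stage variables and data carry the indices \<open>s j\<close> explicitly,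
  so the networks of different pairs never share a variable.
\<close>

record ('s, 'j, 'k::finite, 'r::finite, 'n, 'q::finite) two_stage =
  prob :: "'s \<Rightarrow> real"
  block :: "'j \<Rightarrow> 'k set"
  cost1 :: "real ^ 'k"
  mat :: "real ^ 'k ^ 'r"
  rhs :: "real ^ 'r"
  X_MIO :: "(real ^ 'k) set"
  nodes :: "'s \<Rightarrow> 'j \<Rightarrow> 'n set"
  arcs :: "'s \<Rightarrow> 'j \<Rightarrow> ('n \<times> 'n) set"
  Y_MIO :: "'s \<Rightarrow> 'j \<Rightarrow> 'n \<times> 'n \<Rightarrow> real set"
  cost2 :: "'s \<Rightarrow> 'j \<Rightarrow> 'n \<times> 'n \<Rightarrow> real"
  supply_coef :: "'n \<Rightarrow> 's \<Rightarrow> 'k \<Rightarrow> real"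
  side_coef :: "'n \<times> 'n \<Rightarrow> 's \<Rightarrow> 'j \<Rightarrow> real ^ 'q"
  side_rhs :: "'s \<Rightarrow> 'j \<Rightarrow> real ^ 'q"

text \<open>
  \<open>Y_MIO\<close> must lie in the nonnegative reals for the subproblem with \<open>y \<ge> 0\<close> to be a relaxation
  of the second-stage problem.
\<close>

definition valid_data ::
    "('s::finite, 'j::finite, 'k::finite, 'r::finite, 'n::finite, 'q::finite) two_stage \<Rightarrow> bool" where
  "valid_data P \<longleftrightarrow>
     (\<forall>s. 0 \<le> prob P s) \<and> (\<Sum>s\<in>UNIV. prob P s) = 1 \<and>
     (\<Union>j. block P j) = UNIV \<and> (\<forall>i j. i \<noteq> j \<longrightarrow> block P i \<inter> block P j = {}) \<and>
     (\<forall>s j. arcs P s j \<subseteq> nodes P s j \<times> nodes P s j) \<and>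
     (\<forall>s j. \<forall>a\<in>arcs P s j. Y_MIO P s j a \<subseteq> {0..})"

section \<open>The two-stage problem\<close>

definition first_stage ::
    "('s::finite, 'j::finite, 'k::finite, 'r::finite, 'n::finite, 'q::finite) two_stage \<Rightarrow> (real ^ 'k) set" where
  "first_stage P = {x. rhs P \<le> mat P *v x \<and> x \<in> X_MIO P}"

definition node_supply ::
    "('s::finite, 'j::finite, 'k::finite, 'r::finite, 'n::finite, 'q::finite) two_stage \<Rightarrow>
     's \<Rightarrow> 'j \<Rightarrow> real ^ 'k \<Rightarrow> 'n \<Rightarrow> real" where
  "node_supply P s j x n = (\<Sum>k\<in>block P j. supply_coef P n s k * x $ k)"

text \<open>
  Feasible flows at \<open>x\<close> on the arc set \<open>E\<close> with variable domains \<open>Y\<close>. The second-stage problem,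
  the Benders subproblem and its restrictions in column generation are all of this form. Values
  of \<open>y\<close> off \<open>E\<close> are irrelevant.
\<close>

definition flows ::
    "('s::finite, 'j::finite, 'k::finite, 'r::finite, 'n::finite, 'q::finite) two_stage \<Rightarrow>
     's \<Rightarrow> 'j \<Rightarrow> ('n \<times> 'n) set \<Rightarrow> ('n \<times> 'n \<Rightarrow> real set) \<Rightarrow> real ^ 'k \<Rightarrow> ('n \<times> 'n \<Rightarrow> real) set" where
  "flows P s j E Y x =
     {y. (\<forall>a\<in>E. y a \<in> Y a) \<and>
         (\<forall>n\<in>nodes P s j.
            (\<Sum>m | (n, m) \<in> E. y (n, m)) - (\<Sum>m | (m, n) \<in> E. y (m, n)) = node_supply P s j x n) \<and>
         side_rhs P s j \<le> (\<Sum>a\<in>E. y a *\<^sub>R side_coef P a s j)}"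

definition second_stage ::
    "('s::finite, 'j::finite, 'k::finite, 'r::finite, 'n::finite, 'q::finite) two_stage \<Rightarrow>
     's \<Rightarrow> 'j \<Rightarrow> real ^ 'k \<Rightarrow> ('n \<times> 'n \<Rightarrow> real) set" where
  "second_stage P s j x = flows P s j (arcs P s j) (Y_MIO P s j) x"

definition restricted_benders ::
    "('s::finite, 'j::finite, 'k::finite, 'r::finite, 'n::finite, 'q::finite) two_stage \<Rightarrow>
     's \<Rightarrow> 'j \<Rightarrow> ('n \<times> 'n) set \<Rightarrow> real ^ 'k \<Rightarrow> ('n \<times> 'n \<Rightarrow> real) set" where
  "restricted_benders P s j E x = flows P s j E (\<lambda>_. {0..}) x"

definition flow_cost ::
    "('s::finite, 'j::finite, 'k::finite, 'r::finite, 'n::finite, 'q::finite) two_stage \<Rightarrow>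
     's \<Rightarrow> 'j \<Rightarrow> ('n \<times> 'n \<Rightarrow> real) \<Rightarrow> real" where
  "flow_cost P s j y = (\<Sum>a\<in>arcs P s j. cost2 P s j a * y a)"

definition second_stage_optimal ::
    "('s::finite, 'j::finite, 'k::finite, 'r::finite, 'n::finite, 'q::finite) two_stage \<Rightarrow>
     's \<Rightarrow> 'j \<Rightarrow> real ^ 'k \<Rightarrow> ('n \<times> 'n \<Rightarrow> real) \<Rightarrow> bool" where
  "second_stage_optimal P s j x y \<longleftrightarrow>
     y \<in> second_stage P s j x \<and> (\<forall>y'\<in>second_stage P s j x. flow_cost P s j y \<le> flow_cost P s j y')"

text \<open>The infimum is a minimum under \<open>second_stage_attained\<close> below.\<close>

definition second_stage_value ::
    "('s::finite, 'j::finite, 'k::finite, 'r::finite, 'n::finite, 'q::finite) two_stage \<Rightarrow>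
     's \<Rightarrow> 'j \<Rightarrow> real ^ 'k \<Rightarrow> real" where
  "second_stage_value P s j x = (INF y\<in>second_stage P s j x. flow_cost P s j y)"

definition second_stage_attained ::
    "('s::finite, 'j::finite, 'k::finite, 'r::finite, 'n::finite, 'q::finite) two_stage \<Rightarrow> bool" where
  "second_stage_attained P \<longleftrightarrow>
     (\<forall>x\<in>first_stage P. \<forall>s j. second_stage P s j x \<noteq> {} \<longrightarrow> (\<exists>y. second_stage_optimal P s j x y))"

definition relatively_complete_recourse ::
    "('s::finite, 'j::finite, 'k::finite, 'r::finite, 'n::finite, 'q::finite) two_stage \<Rightarrow> bool" where
  "relatively_complete_recourse P \<longleftrightarrow>
     (\<forall>x\<in>first_stage P. \<forall>s j. second_stage P s j x \<noteq> {})"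

definition global_lower_bound ::
    "('s::finite, 'j::finite, 'k::finite, 'r::finite, 'n::finite, 'q::finite) two_stage \<Rightarrow>
     ('s \<Rightarrow> 'j \<Rightarrow> real) \<Rightarrow> bool" where
  "global_lower_bound P \<Phi> \<longleftrightarrow>
     (\<forall>x\<in>first_stage P. \<forall>s j. \<Phi> s j \<le> second_stage_value P s j x)"

definition first_cost ::
    "('s::finite, 'j::finite, 'k::finite, 'r::finite, 'n::finite, 'q::finite) two_stage \<Rightarrow> real ^ 'k \<Rightarrow> real" where
  "first_cost P x = (\<Sum>j\<in>UNIV. \<Sum>k\<in>block P j. cost1 P $ k * x $ k)"

definition problem_feasible ::
    "('s::finite, 'j::finite, 'k::finite, 'r::finite, 'n::finite, 'q::finite) two_stage \<Rightarrow>
     ((real ^ 'k) \<times> ('s \<Rightarrow> 'j \<Rightarrow> 'n \<times> 'n \<Rightarrow> real)) set" where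
  "problem_feasible P = {(x, y). x \<in> first_stage P \<and> (\<forall>s j. y s j \<in> second_stage P s j x)}"

definition problem_cost ::
    "('s::finite, 'j::finite, 'k::finite, 'r::finite, 'n::finite, 'q::finite) two_stage \<Rightarrow>
     (real ^ 'k) \<times> ('s \<Rightarrow> 'j \<Rightarrow> 'n \<times> 'n \<Rightarrow> real) \<Rightarrow> real" where
  "problem_cost P = (\<lambda>(x, y).
     first_cost P x + (\<Sum>s\<in>UNIV. \<Sum>j\<in>UNIV. prob P s * flow_cost P s j (y s j)))"

definition within_of_optimum ::
    "('s::finite, 'j::finite, 'k::finite, 'r::finite, 'n::finite, 'q::finite) two_stage \<Rightarrow> real \<Rightarrow>
     (real ^ 'k) \<times> ('s \<Rightarrow> 'j \<Rightarrow> 'n \<times> 'n \<Rightarrow> real) \<Rightarrow> bool" where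
  "within_of_optimum P \<delta> z \<longleftrightarrow>
     z \<in> problem_feasible P \<and> (\<forall>z'\<in>problem_feasible P. problem_cost P z \<le> problem_cost P z' + \<delta>)"

definition problem_optimal ::
    "('s::finite, 'j::finite, 'k::finite, 'r::finite, 'n::finite, 'q::finite) two_stage \<Rightarrow>
     (real ^ 'k) \<times> ('s \<Rightarrow> 'j \<Rightarrow> 'n \<times> 'n \<Rightarrow> real) \<Rightarrow> bool" where
  "problem_optimal P z \<longleftrightarrow>
     z \<in> problem_feasible P \<and> (\<forall>z'\<in>problem_feasible P. problem_cost P z \<le> problem_cost P z')"

section \<open>Benders duals\<close>

text \<open>
  Node potentials are indexed by the whole node type; the coordinates outside the network are
  fixed to zero. \<open>dual_set P s j (arcs P s j)\<close> is the dual polyhedron of the Benders subproblem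
  and smaller arc sets give the duals of the restricted subproblems.
\<close>

definition dual_set ::
    "('s::finite, 'j::finite, 'k::finite, 'r::finite, 'n::finite, 'q::finite) two_stage \<Rightarrow>
     's \<Rightarrow> 'j \<Rightarrow> ('n \<times> 'n) set \<Rightarrow> ((real ^ 'n) \<times> (real ^ 'q)) set" where
  "dual_set P s j E =
     {(\<psi>, \<gamma>). (\<forall>n. n \<notin> nodes P s j \<longrightarrow> \<psi> $ n = 0) \<and> 0 \<le> \<gamma> \<and>
        (\<forall>(m, n)\<in>E. \<psi> $ m - \<psi> $ n + \<gamma> \<bullet> side_coef P (m, n) s j \<le> cost2 P s j (m, n))}"

definition dual_obj ::
    "('s::finite, 'j::finite, 'k::finite, 'r::finite, 'n::finite, 'q::finite) two_stage \<Rightarrow>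
     's \<Rightarrow> 'j \<Rightarrow> real ^ 'k \<Rightarrow> (real ^ 'n) \<times> (real ^ 'q) \<Rightarrow> real" where
  "dual_obj P s j x = (\<lambda>(\<psi>, \<gamma>).
     (\<Sum>n\<in>nodes P s j. \<Sum>k\<in>block P j. supply_coef P n s k * x $ k * \<psi> $ n) + side_rhs P s j \<bullet> \<gamma>)"

definition dual_optimal ::
    "('s::finite, 'j::finite, 'k::finite, 'r::finite, 'n::finite, 'q::finite) two_stage \<Rightarrow>
     's \<Rightarrow> 'j \<Rightarrow> ('n \<times> 'n) set \<Rightarrow> real ^ 'k \<Rightarrow> (real ^ 'n) \<times> (real ^ 'q) \<Rightarrow> bool" where
  "dual_optimal P s j E x d \<longleftrightarrow>
     d \<in> dual_set P s j E \<and> (\<forall>d'\<in>dual_set P s j E. dual_obj P s j x d' \<le> dual_obj P s j x d)"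

definition reduced_cost ::
    "('s::finite, 'j::finite, 'k::finite, 'r::finite, 'n::finite, 'q::finite) two_stage \<Rightarrow>
     's \<Rightarrow> 'j \<Rightarrow> (real ^ 'n) \<times> (real ^ 'q) \<Rightarrow> 'n \<times> 'n \<Rightarrow> real" where
  "reduced_cost P s j = (\<lambda>(\<psi>, \<gamma>) (m, n).
     cost2 P s j (m, n) - (\<psi> $ m - \<psi> $ n) - \<gamma> \<bullet> side_coef P (m, n) s j)"

text \<open>Extended reals give the minimum over an empty arc set the value \<open>\<infinity>\<close>.\<close>

definition min_reduced_cost ::
    "('s::finite, 'j::finite, 'k::finite, 'r::finite, 'n::finite, 'q::finite) two_stage \<Rightarrow>
     's \<Rightarrow> 'j \<Rightarrow> (real ^ 'n) \<times> (real ^ 'q) \<Rightarrow> ereal" where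
  "min_reduced_cost P s j d = (INF a\<in>arcs P s j. ereal (reduced_cost P s j d a))"

text \<open>
  Potentials enter the dual constraints only through differences, so adding a constant to all
  potentials of a network stays inside its dual polyhedron. A nonempty network therefore has a
  dual polyhedron that contains lines and has no extreme points in the literal sense. The usual
  remedy (fixing a reference potential in every connected component) amounts to taking extreme
  points modulo the lineality space, which is what \<open>extreme_mod_lineality\<close> does, without
  committing to a choice of representatives. On sets without lines this is
  \<open>extreme_point_of\<close>.
\<close>

definition lineality_space :: "'v::real_vector set \<Rightarrow> 'v set" where
  "lineality_space Q = {v. \<forall>z\<in>Q. \<forall>t. z + t *\<^sub>R v \<in> Q}"

definition extreme_mod_lineality :: "'v::real_vector \<Rightarrow> 'v set \<Rightarrow> bool" where
  "extreme_mod_lineality z Q \<longleftrightarrow>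
     z \<in> Q \<and> (\<forall>a\<in>Q. \<forall>b\<in>Q. z \<in> open_segment a b \<longrightarrow> b - a \<in> lineality_space Q)"

lemma extreme_mod_lineality_eq_extreme_point_of:
  assumes "lineality_space Q = {0}"
  shows "extreme_mod_lineality z Q \<longleftrightarrow> z extreme_point_of Q"
  using assms by (fastforce simp: extreme_mod_lineality_def extreme_point_of_def)

definition dual_extreme ::
    "('s::finite, 'j::finite, 'k::finite, 'r::finite, 'n::finite, 'q::finite) two_stage \<Rightarrow>
     's \<Rightarrow> 'j \<Rightarrow> ((real ^ 'n) \<times> (real ^ 'q)) set" where
  "dual_extreme P s j = {d. extreme_mod_lineality d (dual_set P s j (arcs P s j))}"

section \<open>The algorithm\<close>

definition L_shaped_bound ::
    "('s::finite, 'j::finite, 'k::finite, 'r::finite, 'n::finite, 'q::finite) two_stage \<Rightarrow>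
     ('s \<Rightarrow> 'j \<Rightarrow> real) \<Rightarrow> 's \<Rightarrow> 'j \<Rightarrow> real ^ 'k \<Rightarrow> real ^ 'k \<Rightarrow> real" where
  "L_shaped_bound P \<Phi> s j w x =
     \<Phi> s j + (second_stage_value P s j w - \<Phi> s j) *
       (1 - (\<Sum>k | k \<in> block P j \<and> w $ k = 1. 1 - x $ k) - (\<Sum>k | k \<in> block P j \<and> w $ k = 0. x $ k))"

definition master_feasible ::
    "('s::finite, 'j::finite, 'k::finite, 'r::finite, 'n::finite, 'q::finite) two_stage \<Rightarrow>
     ('s \<Rightarrow> 'j \<Rightarrow> real) \<Rightarrow> ('s \<Rightarrow> 'j \<Rightarrow> ((real ^ 'n) \<times> (real ^ 'q)) set) \<Rightarrow> (real ^ 'k) list \<Rightarrow>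
     ((real ^ 'k) \<times> ('s \<Rightarrow> 'j \<Rightarrow> real)) set" where
  "master_feasible P \<Phi> U W =
     {(x, \<theta>). x \<in> first_stage P \<and>
        (\<forall>s j. \<forall>u\<in>U s j. \<theta> s j \<ge> dual_obj P s j x u) \<and>
        (\<forall>s j. \<forall>w\<in>set W. \<theta> s j \<ge> L_shaped_bound P \<Phi> s j w x)}"

definition master_cost ::
    "('s::finite, 'j::finite, 'k::finite, 'r::finite, 'n::finite, 'q::finite) two_stage \<Rightarrow>
     (real ^ 'k) \<times> ('s \<Rightarrow> 'j \<Rightarrow> real) \<Rightarrow> real" where
  "master_cost P = (\<lambda>(x, \<theta>). first_cost P x + (\<Sum>s\<in>UNIV. \<Sum>j\<in>UNIV. prob P s * \<theta> s j))"

definition master_optimal ::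
    "('s::finite, 'j::finite, 'k::finite, 'r::finite, 'n::finite, 'q::finite) two_stage \<Rightarrow>
     ('s \<Rightarrow> 'j \<Rightarrow> real) \<Rightarrow> ('s \<Rightarrow> 'j \<Rightarrow> ((real ^ 'n) \<times> (real ^ 'q)) set) \<Rightarrow> (real ^ 'k) list \<Rightarrow>
     (real ^ 'k) \<times> ('s \<Rightarrow> 'j \<Rightarrow> real) \<Rightarrow> bool" where
  "master_optimal P \<Phi> U W z \<longleftrightarrow>
     z \<in> master_feasible P \<Phi> U W \<and> (\<forall>z'\<in>master_feasible P \<Phi> U W. master_cost P z \<le> master_cost P z')"

definition gap ::
    "('s::finite, 'j::finite, 'k::finite, 'r::finite, 'n::finite, 'q::finite) two_stage \<Rightarrow>
     real ^ 'k \<Rightarrow> ('s \<Rightarrow> 'j \<Rightarrow> real) \<Rightarrow> real" where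
  "gap P x \<theta> = (\<Sum>s\<in>UNIV. prob P s * (\<Sum>j\<in>UNIV. second_stage_value P s j x - \<theta> s j))"

text \<open>
  \<open>Master U W\<close>: about to solve the master problem with Benders cuts \<open>U\<close> and visited solutions \<open>W\<close>.
  \<open>Column_generation U W x \<theta> E\<close>: solving the Benders subproblems at \<open>x\<close> with restricted arc sets
  \<open>E\<close>. \<open>Integer U W x \<theta>\<close>: no Benders cut is violated by \<open>(x, \<theta>)\<close>, the second-stage problems with
  integrality requirements are to be solved. \<open>Infeasible\<close> and \<open>Returned x y\<close> are terminal.
\<close>

datatype ('s, 'j, 'k::finite, 'n::finite, 'q::finite) dd_ils_state =
    Master "'s \<Rightarrow> 'j \<Rightarrow> ((real ^ 'n) \<times> (real ^ 'q)) set" "(real ^ 'k) list"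
  | Column_generation "'s \<Rightarrow> 'j \<Rightarrow> ((real ^ 'n) \<times> (real ^ 'q)) set" "(real ^ 'k) list"
      "real ^ 'k" "'s \<Rightarrow> 'j \<Rightarrow> real" "'s \<Rightarrow> 'j \<Rightarrow> ('n \<times> 'n) set"
  | Integer "'s \<Rightarrow> 'j \<Rightarrow> ((real ^ 'n) \<times> (real ^ 'q)) set" "(real ^ 'k) list"
      "real ^ 'k" "'s \<Rightarrow> 'j \<Rightarrow> real"
  | Infeasible
  | Returned "real ^ 'k" "'s \<Rightarrow> 'j \<Rightarrow> 'n \<times> 'n \<Rightarrow> real"

text \<open>
  All choices left to the solvers (optimal solutions, initial restricted arc sets, entering arcs,
  dual extreme points) are nondeterministic. Column generation starts from arc sets on which the
  restricted subproblems are feasible, since otherwise these have no dual solution. In the rules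
  \<open>add_benders_cuts\<close> and \<open>benders_converged\<close> the extreme points \<open>u s j\<close> are matched to
  the final column generation dual \<open>d s j\<close> by their objective value.
\<close>

inductive dd_ils_step ::
    "('s::finite, 'j::finite, 'k::finite, 'r::finite, 'n::finite, 'q::finite) two_stage \<Rightarrow>
     ('s \<Rightarrow> 'j \<Rightarrow> real) \<Rightarrow> real \<Rightarrow>
     ('s, 'j, 'k, 'n, 'q) dd_ils_state \<Rightarrow> ('s, 'j, 'k, 'n, 'q) dd_ils_state \<Rightarrow> bool"
  for P \<Phi> \<epsilon> where
  master_infeasible:
    "dd_ils_step P \<Phi> \<epsilon> (Master U W) Infeasible"
    if "master_feasible P \<Phi> U W = {}"
| master_solved:
    "dd_ils_step P \<Phi> \<epsilon> (Master U W) (Column_generation U W x \<theta> E)"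
    if "master_optimal P \<Phi> U W (x, \<theta>)"
       "\<And>s j. E s j \<subseteq> arcs P s j"
       "\<And>s j. restricted_benders P s j (E s j) x \<noteq> {}"
| generate_columns:
    "dd_ils_step P \<Phi> \<epsilon> (Column_generation U W x \<theta> E) (Column_generation U W x \<theta> E')"
    if "\<And>s j. dual_optimal P s j (E s j) x (d s j)"
       "\<exists>s j. min_reduced_cost P s j (d s j) < 0"
       "\<And>s j. if min_reduced_cost P s j (d s j) < 0
              then \<exists>a\<in>arcs P s j. ereal (reduced_cost P s j (d s j) a) = min_reduced_cost P s j (d s j) \<and>
                                  E' s j = insert a (E s j)
              else E' s j = E s j"
| add_benders_cuts:
    "dd_ils_step P \<Phi> \<epsilon> (Column_generation U W x \<theta> E)
       (Master (\<lambda>s j. if \<theta> s j < dual_obj P s j x (u s j) then insert (u s j) (U s j) else U s j) W)"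
    if "\<And>s j. dual_optimal P s j (E s j) x (d s j)"
       "\<And>s j. min_reduced_cost P s j (d s j) \<ge> 0"
       "\<And>s j. u s j \<in> dual_extreme P s j"
       "\<And>s j. dual_obj P s j x (u s j) = dual_obj P s j x (d s j)"
       "\<exists>s j. \<theta> s j < dual_obj P s j x (u s j)"
| benders_converged:
    "dd_ils_step P \<Phi> \<epsilon> (Column_generation U W x \<theta> E) (Integer U W x \<theta>)"
    if "\<And>s j. dual_optimal P s j (E s j) x (d s j)"
       "\<And>s j. min_reduced_cost P s j (d s j) \<ge> 0"
       "\<And>s j. u s j \<in> dual_extreme P s j"
       "\<And>s j. dual_obj P s j x (u s j) = dual_obj P s j x (d s j)"
       "\<And>s j. \<theta> s j \<ge> dual_obj P s j x (u s j)"
| gap_closed: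
    "dd_ils_step P \<Phi> \<epsilon> (Integer U W x \<theta>) (Returned x y)"
    if "\<And>s j. second_stage_optimal P s j x (y s j)"
       "gap P x \<theta> < \<epsilon>"
| add_L_shaped_cuts:
    "dd_ils_step P \<Phi> \<epsilon> (Integer U W x \<theta>) (Master U (W @ [x]))"
    if "gap P x \<theta> \<ge> \<epsilon>"

text \<open>
  Initial cuts are arbitrary, except that the first master problem has to be bounded: without any
  cuts nothing bounds \<open>\<theta>\<close> from below and the master problem has no solution.
\<close>

definition dd_ils_initial ::
    "('s::finite, 'j::finite, 'k::finite, 'r::finite, 'n::finite, 'q::finite) two_stage \<Rightarrow>
     ('s \<Rightarrow> 'j \<Rightarrow> real) \<Rightarrow> ('s, 'j, 'k, 'n, 'q) dd_ils_state \<Rightarrow> bool" where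
  "dd_ils_initial P \<Phi> st \<longleftrightarrow>
     (\<exists>U W. st = Master U W \<and>
        (\<forall>s j. finite (U s j) \<and> U s j \<subseteq> dual_extreme P s j) \<and>
        set W \<subseteq> first_stage P \<and>
        bdd_below (master_cost P ` master_feasible P \<Phi> U W))"

text \<open>
  No run is infinite, and a state in which a run cannot be continued satisfies \<open>good\<close>; in
  particular a run never gets stuck in a state that is not \<open>good\<close>.
\<close>

definition dd_ils_converges ::
    "('s::finite, 'j::finite, 'k::finite, 'r::finite, 'n::finite, 'q::finite) two_stage \<Rightarrow>
     ('s \<Rightarrow> 'j \<Rightarrow> real) \<Rightarrow> real \<Rightarrow> (('s, 'j, 'k, 'n, 'q) dd_ils_state \<Rightarrow> bool) \<Rightarrow> bool" where
  "dd_ils_converges P \<Phi> \<epsilon> good \<longleftrightarrow>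
     (\<forall>st0. dd_ils_initial P \<Phi> st0 \<longrightarrow>
        \<not> (\<exists>\<sigma>. \<sigma> 0 = st0 \<and> (\<forall>i::nat. dd_ils_step P \<Phi> \<epsilon> (\<sigma> i) (\<sigma> (Suc i)))) \<and>
        (\<forall>st. (dd_ils_step P \<Phi> \<epsilon>)\<^sup>*\<^sup>* st0 st \<and> \<not> (\<exists>st'. dd_ils_step P \<Phi> \<epsilon> st st') \<longrightarrow> good st))"

definition ends_with ::
    "('s::finite, 'j::finite, 'k::finite, 'r::finite, 'n::finite, 'q::finite) two_stage \<Rightarrow>
     ((real ^ 'k) \<times> ('s \<Rightarrow> 'j \<Rightarrow> 'n \<times> 'n \<Rightarrow> real) \<Rightarrow> bool) \<Rightarrow>
     ('s, 'j, 'k, 'n, 'q) dd_ils_state \<Rightarrow> bool" where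
  "ends_with P opt st \<longleftrightarrow>
     (if problem_feasible P = {} then st = Infeasible
      else \<exists>x y. st = Returned x y \<and> opt (x, y))"

end

theory Submission
  imports Defs
begin

text \<open>
  Every cut is valid: an optimality cut by weak duality of the Benders subproblem, which relaxes
  the second-stage problem (\<open>benders_cut_valid\<close>), and an integer L-shaped cut because its
  right-hand side is the exact value at the visited point and at most the global lower bound at
  every binary point that differs from it on the block (\<open>L_shaped_cut_valid\<close>). So the master
  optimum never exceeds the optimal cost. The cost of a returned solution exceeds the master
  optimum by the gap, which is less than \<open>\<epsilon>\<close>. As there are only finitely many first-stage
  solutions, a small enough \<open>\<epsilon>\<close> separates the optimal cost from all other costs
  (\<open>ex_separating_tolerance\<close>) and the returned solution is optimal.

  For termination, each stage makes progress in a finite set. An arc that enters in column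
  generation has negative reduced cost, so it was not in the restricted arc set. At a visited
  point the L-shaped cuts are exact, so the gap is nonpositive and no point is added to the list
  twice. The extreme points of a dual polyhedron modulo its lineality space may be infinitely
  many, but two of them with the same tight constraints differ by a lineality direction. The dual
  objective at a feasible first-stage solution is bounded, by weak duality and recourse, and
  therefore constant along lineality directions (\<open>dual_extreme_obj_eq\<close>). Hence a violated
  optimality cut comes with a set of tight constraints that no present cut has, and there are
  finitely many such sets. The measure in \<open>step_decreases\<close>
  combines these facts lexicographically.

  A run cannot get stuck before it terminates (\<open>run_continues\<close>). Master problems attain their
  minimum, since the first-stage set is finite and each \<open>\<theta> s j\<close> can be lowered to its largest
  cut. The dual problems attain their maximum, also at an extreme point: from any feasible point
  one can move in a direction of the polyhedron that does not decrease the objective until a new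
  constraint becomes tight, and this ends in an extreme point modulo lineality
  (\<open>ex_extreme_above\<close>). Extreme points have finitely many objective values, so the largest of
  these is the maximum (\<open>attains_maximum\<close>).
\<close>

section \<open>Linear inequality systems\<close>

text \<open>
  A polyhedron given by finitely many linear inequalities inside a linear subspace. The subspace
  carries the linear equations.
\<close>

locale linear_system =
  fixes L :: "'v::real_vector set" and I :: "'i set" and f :: "'i \<Rightarrow> 'v \<Rightarrow> real" and b :: "'i \<Rightarrow> real"
  assumes subspace_L: "subspace L"
    and finite_I: "finite I"
    and linear_f: "\<And>i. linear (f i)"
begin

definition solutions :: "'v set" where
  "solutions = {z \<in> L. \<forall>i\<in>I. f i z \<le> b i}"

text \<open>The inequalities that hold with equality.\<close>

definition tight :: "'v \<Rightarrow> 'i set" where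
  "tight z = {i \<in> I. f i z = b i}"

lemma f_simps:
  "f i (z + t *\<^sub>R v) = f i z + t * f i v" "f i (v - w) = f i v - f i w" "f i (- v) = - f i v"
  using linear_f[of i] by (simp_all add: linear_add linear_scale linear_diff linear_neg)

lemma move_in_L: "z \<in> L \<Longrightarrow> v \<in> L \<Longrightarrow> z + t *\<^sub>R v \<in> L"
  using subspace_L by (simp add: subspace_add subspace_scale)

lemma lineality_spaceI:
  assumes "v \<in> L" "\<And>i. i \<in> I \<Longrightarrow> f i v = 0"
  shows "v \<in> lineality_space solutions"
  using assms by (auto simp: lineality_space_def solutions_def move_in_L f_simps)

lemma tight_constant_on_segment:
  assumes "p \<in> solutions" "q \<in> solutions" "z \<in> open_segment p q" "i \<in> tight z"
  shows "f i (q - p) = 0"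
proof -
  obtain u where u: "0 < u" "u < 1" "z = (1 - u) *\<^sub>R p + u *\<^sub>R q"
    using assms(3) by (auto simp: in_segment)
  have fz: "f i z = (1 - u) * f i p + u * f i q"
    using linear_f[of i] u(3) by (simp add: linear_add linear_scale)
  have i: "i \<in> I" "f i z = b i" using assms(4) by (auto simp: tight_def)
  have le: "f i p \<le> b i" "f i q \<le> b i" using assms(1,2) i by (auto simp: solutions_def)
  have "(1 - u) * (b i - f i p) + u * (b i - f i q) = 0"
    using fz i by (simp add: algebra_simps)
  moreover have "(1 - u) * (b i - f i p) \<ge> 0" "u * (b i - f i q) \<ge> 0"
    using u le by auto
  ultimately have "(1 - u) * (b i - f i p) = 0" "u * (b i - f i q) = 0" by linarith+
  then have "f i p = b i" "f i q = b i" using u by auto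
  then show ?thesis by (simp add: f_simps)
qed

text \<open>The ratio test of the simplex method.\<close>

lemma move_to_new_tight:
  assumes z: "z \<in> solutions" and v: "v \<in> L"
    and const: "\<And>i. i \<in> tight z \<Longrightarrow> f i v = 0"
    and i1: "i1 \<in> I" "f i1 v > 0"
  obtains t where "t \<ge> 0" "z + t *\<^sub>R v \<in> solutions" "tight z \<subset> tight (z + t *\<^sub>R v)"
proof -
  define J where "J = {i \<in> I. f i v > 0}"
  define r where "r = (\<lambda>i. (b i - f i z) / f i v)"
  define t where "t = Min (r ` J)"
  have J: "finite J" "J \<noteq> {}" using finite_I i1 by (auto simp: J_def)
  have fz: "\<And>i. i \<in> I \<Longrightarrow> f i z \<le> b i" using z by (auto simp: solutions_def)
  have "t \<in> r ` J" unfolding t_def using J by (intro Min_in) auto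
  then obtain i0 where i0: "i0 \<in> J" "t = r i0" by auto
  have t0: "t \<ge> 0" using i0 fz by (auto simp: r_def J_def)
  have step: "t * f i v \<le> b i - f i z" if "i \<in> I" for i
  proof (cases "f i v > 0")
    case True
    then have "t \<le> r i" unfolding t_def using J that by (intro Min_le) (auto simp: J_def)
    then show ?thesis using True by (simp add: r_def field_simps)
  next
    case False
    then have "t * f i v \<le> 0" using t0 by (simp add: mult_nonneg_nonpos)
    then show ?thesis using fz[OF that] by linarith
  qed
  have "z + t *\<^sub>R v \<in> solutions"
    using step z v by (auto simp: solutions_def f_simps move_in_L algebra_simps)
  moreover have "tight z \<subseteq> tight (z + t *\<^sub>R v)"
    using const by (auto simp: tight_def f_simps)
  moreover have "i0 \<in> tight (z + t *\<^sub>R v)"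
    using i0 by (auto simp: tight_def f_simps J_def r_def)
  moreover have "i0 \<notin> tight z" using const i0 by (auto simp: J_def)
  ultimately show ?thesis using that t0 by blast
qed

text \<open>
  While the point is interior to a segment whose direction is not in the lineality space, move
  along that direction, or its opposite, until another inequality becomes tight.
\<close>

lemma ex_extreme_above:
  fixes c :: "'v \<Rightarrow> real"
  assumes c: "linear c" and B: "\<And>q. q \<in> solutions \<Longrightarrow> c q \<le> B"
    and z: "z \<in> solutions"
  shows "\<exists>u. extreme_mod_lineality u solutions \<and> c z \<le> c u"
  using z
proof (induction "card (I - tight z)" arbitrary: z rule: less_induct)
  case less
  show ?case
  proof (cases "extreme_mod_lineality z solutions")
    case True
    then show ?thesis by auto
  next
    case False
    then obtain p q where pq: "p \<in> solutions" "q \<in> solutions" "z \<in> open_segment p q"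
        "q - p \<notin> lineality_space solutions"
      using less.prems by (auto simp: extreme_mod_lineality_def)
    have qpL: "q - p \<in> L" using pq subspace_L by (auto simp: solutions_def subspace_diff)
    have const: "f i (q - p) = 0" if "i \<in> tight z" for i
      using tight_constant_on_segment[OF pq(1-3) that] .
    obtain i1 where i1: "i1 \<in> I" "f i1 (q - p) \<noteq> 0"
      using lineality_spaceI[OF qpL] pq(4) by blast
    have clin: "c (z + t *\<^sub>R v) = c z + t * c v" for t v
      using c by (simp add: linear_add linear_scale)
    have cneg: "c (- v) = - c v" for v using c by (simp add: linear_neg)
    \<comment> \<open>A non-decreasing direction that leaves the polyhedron.\<close>
    have "\<exists>v. (v = q - p \<or> v = - (q - p)) \<and> c v \<ge> 0 \<and> (\<exists>i\<in>I. f i v > 0)"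
    proof -
      define v where "v = (if c (q - p) \<ge> 0 then q - p else - (q - p))"
      have v: "v = q - p \<or> v = - (q - p)" "c v \<ge> 0"
        using cneg[of "q - p"] by (auto simp: v_def)
      have vL: "v \<in> L" using v(1) qpL subspace_neg[OF subspace_L qpL] by metis
      have fv: "f i1 v \<noteq> 0" using v(1) i1(2) f_simps(3)[of i1 "q - p"] by auto
      show ?thesis
      proof (cases "\<exists>i\<in>I. f i v > 0")
        case True
        then show ?thesis using v by blast
      next
        case no: False
        \<comment> \<open>A ray in direction \<open>v\<close> on which \<open>c\<close> cannot increase, so \<open>- v\<close> is as good as \<open>v\<close>.\<close>
        have "c v = 0"
        proof (rule ccontr)
          assume "c v \<noteq> 0"
          then have cv: "c v > 0" using v(2) by simp
          \<comment> \<open>Far enough along the ray for \<open>c\<close> to exceed \<open>B\<close>.\<close>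
          define t where "t = max 0 ((B - c z) / c v + 1)"
          have "t * f i v \<le> 0" if "i \<in> I" for i
            using no that by (simp add: mult_nonneg_nonpos t_def not_less)
          then have "z + t *\<^sub>R v \<in> solutions"
            using less.prems vL by (force simp: solutions_def f_simps move_in_L)
          then have "c z + t * c v \<le> B" using B clin by metis
          moreover have "((B - c z) / c v + 1) * c v \<le> t * c v"
            using cv by (intro mult_right_mono) (auto simp: t_def)
          moreover have "((B - c z) / c v + 1) * c v = B - c z + c v"
            using cv by (simp add: field_simps)
          ultimately show False using cv by linarith
        qed
        moreover have "f i1 (- v) > 0"
          using no i1(1) fv f_simps(3)[of i1 v] by force
        moreover have "- v = q - p \<or> - v = - (q - p)" using v(1) by auto
        ultimately show ?thesis using i1(1) cneg[of v]
          by (intro exI[of _ "- v"]) auto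
      qed
    qed
    then obtain v i where v: "v = q - p \<or> v = - (q - p)" "c v \<ge> 0" "i \<in> I" "f i v > 0" by blast
    have vL: "v \<in> L" using v(1) qpL subspace_neg[OF subspace_L qpL] by metis
    have constv: "f i v = 0" if "i \<in> tight z" for i
      using const[OF that] v(1) f_simps(3)[of i "q - p"] by auto
    obtain t where t: "t \<ge> 0" "z + t *\<^sub>R v \<in> solutions" "tight z \<subset> tight (z + t *\<^sub>R v)"
      using move_to_new_tight[OF less.prems vL constv v(3,4)] by blast
    have "I - tight (z + t *\<^sub>R v) \<subset> I - tight z" using t(3) by (auto simp: tight_def)
    then have "card (I - tight (z + t *\<^sub>R v)) < card (I - tight z)"
      using finite_I by (intro psubset_card_mono) auto
    from less.hyps[OF this t(2)] obtain u where
      "extreme_mod_lineality u solutions" "c (z + t *\<^sub>R v) \<le> c u" by blast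
    moreover have "c z \<le> c (z + t *\<^sub>R v)" using clin t(1) v(2) by simp
    ultimately show ?thesis by fastforce
  qed
qed

text \<open>
  Extreme points with the same tight inequalities differ by a lineality direction, and a bounded
  linear function is constant along those.
\<close>

lemma extreme_value_determined_by_tight:
  fixes c :: "'v \<Rightarrow> real"
  assumes c: "linear c" and B: "\<And>q. q \<in> solutions \<Longrightarrow> c q \<le> B"
    and z: "extreme_mod_lineality z solutions" and z': "z' \<in> solutions"
    and eq: "tight z = tight z'"
  shows "c z = c z'"
proof (rule ccontr)
  assume ne: "c z \<noteq> c z'"
  define v where "v = z' - z"
  have zS: "z \<in> solutions" using z by (simp add: extreme_mod_lineality_def)
  have vL: "v \<in> L" using zS z' subspace_L by (auto simp: v_def solutions_def subspace_diff)
  have cv: "c v \<noteq> 0" using ne c by (simp add: v_def linear_diff)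
  have clin: "c (x + t *\<^sub>R w) = c x + t * c w" for t x w
    using c by (simp add: linear_add linear_scale)
  have tv: "f i v = 0" if "i \<in> tight z" for i
    using that eq by (auto simp: v_def f_simps tight_def)
  \<comment> \<open>A step short enough to respect all constraints that are not tight, in both directions.\<close>
  have "\<forall>\<^sub>F t in at_right 0. \<forall>i\<in>I. \<bar>t * f i v\<bar> \<le> b i - f i z"
  proof (rule eventually_ball_finite[OF finite_I], rule ballI)
    fix i assume i: "i \<in> I"
    show "\<forall>\<^sub>F t in at_right 0. \<bar>t * f i v\<bar> \<le> b i - f i z"
    proof (cases "i \<in> tight z")
      case True
      then show ?thesis using tv by (auto simp: tight_def)
    next
      case False
      then have pos: "0 < b i - f i z" using i zS by (force simp: tight_def solutions_def)
      have "((\<lambda>t. \<bar>t * f i v\<bar>) \<longlongrightarrow> \<bar>0 * f i v\<bar>) (at_right 0)"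
        by (intro tendsto_intros)
      then have "\<forall>\<^sub>F t in at_right 0. \<bar>t * f i v\<bar> < b i - f i z"
        using pos by (intro order_tendstoD(2)[of _ "\<bar>0 * f i v\<bar>"]) auto
      then show ?thesis by (rule eventually_mono) auto
    qed
  qed
  then have "\<forall>\<^sub>F t in at_right 0. (\<forall>i\<in>I. \<bar>t * f i v\<bar> \<le> b i - f i z) \<and> 0 < t"
    by (intro eventually_conj) (auto simp: eventually_at_right_less)
  then obtain t :: real where t: "t > 0" "\<And>i. i \<in> I \<Longrightarrow> \<bar>t * f i v\<bar> \<le> b i - f i z"
    using eventually_happens[of _ "at_right (0::real)"] trivial_limit_at_right_real by blast
  have mem: "z + r *\<^sub>R v \<in> solutions" if "\<bar>r\<bar> = t" for r
  proof -
    have "r * f i v \<le> b i - f i z" if "i \<in> I" for i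
      using t(2)[OF that] \<open>\<bar>r\<bar> = t\<close> t(1) abs_ge_self[of "r * f i v"]
      by (simp add: abs_mult)
    then show ?thesis
      using zS vL by (force simp: solutions_def f_simps move_in_L)
  qed
  have v0: "v \<noteq> 0" using cv c by (auto simp: linear_0)
  have "z \<in> open_segment (z + (- t) *\<^sub>R v) (z + t *\<^sub>R v)"
    unfolding in_segment
  proof (intro conjI exI[of _ "1/2"])
    show "z + (- t) *\<^sub>R v \<noteq> z + t *\<^sub>R v"
      using t(1) v0 by (simp del: scaleR_minus_left)
    show "z = (1 - 1/2) *\<^sub>R (z + (- t) *\<^sub>R v) + (1/2) *\<^sub>R (z + t *\<^sub>R v)"
      by (simp add: algebra_simps flip: scaleR_add_left)
  qed auto
  moreover have "z + (- t) *\<^sub>R v \<in> solutions" "z + t *\<^sub>R v \<in> solutions"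
    using mem[of "- t"] mem[of t] t(1) by auto
  ultimately have lin: "(z + t *\<^sub>R v) - (z + (- t) *\<^sub>R v) \<in> lineality_space solutions"
    using z unfolding extreme_mod_lineality_def by blast
  have "(z + t *\<^sub>R v) - (z + (- t) *\<^sub>R v) = (2 * t) *\<^sub>R v"
    by (simp add: scaleR_add_left[symmetric])
  with lin have lin: "(2 * t) *\<^sub>R v \<in> lineality_space solutions" by simp
  \<comment> \<open>On the line through \<open>z\<close> in direction \<open>v\<close>, \<open>c\<close> takes the value \<open>B + 1\<close>.\<close>
  define r where "r = ((B - c z) + 1) / (2 * t * c v)"
  have "z + r *\<^sub>R ((2 * t) *\<^sub>R v) \<in> solutions"
    using lin zS by (auto simp: lineality_space_def)
  from B[OF this] have "c z + r * (2 * t * c v) \<le> B"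
    unfolding clin using c by (simp add: linear_scale)
  moreover have "r * (2 * t * c v) = B - c z + 1"
    using cv t(1) by (simp add: r_def)
  ultimately show False by linarith
qed

text \<open>
  The maximum over the polyhedron is the largest of the values at extreme points, of which there
  are finitely many, at most one for each set of tight inequalities.
\<close>

lemma attains_maximum:
  fixes c :: "'v \<Rightarrow> real"
  assumes c: "linear c" and B: "\<And>q. q \<in> solutions \<Longrightarrow> c q \<le> B"
    and ne: "solutions \<noteq> {}"
  shows "\<exists>z\<in>solutions. \<forall>q\<in>solutions. c q \<le> c z"
proof -
  define X where "X = {u. extreme_mod_lineality u solutions}"
  have XS: "X \<subseteq> solutions" by (auto simp: X_def extreme_mod_lineality_def)
  have "c u = c (SOME w. w \<in> X \<and> tight w = tight u)" if "u \<in> X" for u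
  proof -
    have "(SOME w. w \<in> X \<and> tight w = tight u) \<in> X \<and> tight (SOME w. w \<in> X \<and> tight w = tight u) = tight u"
      by (rule someI[of _ u]) (use that in auto)
    then show ?thesis
      using extreme_value_determined_by_tight[OF c B] that XS by (auto simp: X_def)
  qed
  then have "c ` X \<subseteq> (\<lambda>T. c (SOME w. w \<in> X \<and> tight w = T)) ` Pow I"
    by (auto simp: tight_def image_iff)
  then have fin: "finite (c ` X)" using finite_I by (rule_tac finite_surj) auto
  have "X \<noteq> {}" using ex_extreme_above[OF c B] ne by (auto simp: X_def)
  then have "Max (c ` X) \<in> c ` X" using fin by (intro Max_in) auto
  then obtain z where z: "z \<in> X" "c z = Max (c ` X)" by auto
  have "c q \<le> c z" if "q \<in> solutions" for q
  proof -
    obtain u where "u \<in> X" "c q \<le> c u"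
      using ex_extreme_above[OF c B] \<open>q \<in> solutions\<close> by (fastforce simp: X_def)
    moreover then have "c u \<le> c z" using z fin by auto
    ultimately show ?thesis by linarith
  qed
  then show ?thesis using z XS by blast
qed

end

section \<open>Duality for the Benders subproblems\<close>

text \<open>
  \<open>dual_set P s j E\<close> as a linear system: the potentials vanish off the network (the subspace
  \<open>dual_space\<close>), and there is one inequality for each arc in \<open>E\<close> (\<open>Inl\<close>) and one sign constraint
  \<open>- \<gamma> $ q \<le> 0\<close> for each side-constraint row (\<open>Inr\<close>).
\<close>

definition dual_space ::
    "('s::finite, 'j::finite, 'k::finite, 'r::finite, 'n::finite, 'q::finite) two_stage \<Rightarrow>
     's \<Rightarrow> 'j \<Rightarrow> ((real ^ 'n) \<times> (real ^ 'q)) set" where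
  "dual_space P s j = {(\<psi>, \<gamma>). \<forall>n. n \<notin> nodes P s j \<longrightarrow> \<psi> $ n = 0}"

definition dual_index :: "('n::finite \<times> 'n) set \<Rightarrow> (('n \<times> 'n) + 'q::finite) set" where
  "dual_index E = Inl ` E \<union> range Inr"

definition dual_lhs ::
    "('s::finite, 'j::finite, 'k::finite, 'r::finite, 'n::finite, 'q::finite) two_stage \<Rightarrow>
     's \<Rightarrow> 'j \<Rightarrow> ('n \<times> 'n) + 'q \<Rightarrow> (real ^ 'n) \<times> (real ^ 'q) \<Rightarrow> real" where
  "dual_lhs P s j i d = (case i of
     Inl a \<Rightarrow> fst d $ fst a - fst d $ snd a + snd d \<bullet> side_coef P a s j
   | Inr q \<Rightarrow> - snd d $ q)"

definition dual_rhs ::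
    "('s::finite, 'j::finite, 'k::finite, 'r::finite, 'n::finite, 'q::finite) two_stage \<Rightarrow>
     's \<Rightarrow> 'j \<Rightarrow> ('n \<times> 'n) + 'q \<Rightarrow> real" where
  "dual_rhs P s j i = (case i of Inl a \<Rightarrow> cost2 P s j a | Inr q \<Rightarrow> 0)"

interpretation dual_system:
  linear_system "dual_space P s j" "dual_index E" "dual_lhs P s j" "dual_rhs P s j"
  for P :: "('s::finite, 'j::finite, 'k::finite, 'r::finite, 'n::finite, 'q::finite) two_stage"
    and s j E
proof (rule linear_system.intro)
  show "subspace (dual_space P s j)"
    by (auto simp: subspace_def dual_space_def zero_prod_def)
  show "linear (dual_lhs P s j i)" for i
    by (cases i) (auto intro!: linearI simp: dual_lhs_def inner_add_left algebra_simps)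
qed simp

lemma dual_system_solutions:
  "linear_system.solutions (dual_space P s j) (dual_index E) (dual_lhs P s j) (dual_rhs P s j) =
   dual_set P s j E"
  unfolding dual_system.solutions_def
  by (auto simp: dual_space_def dual_index_def dual_lhs_def dual_rhs_def
      dual_set_def less_eq_vec_def ball_Un)

text \<open>The dual constraints of the full network that hold with equality at \<open>d\<close>.\<close>

definition dual_tight ::
    "('s::finite, 'j::finite, 'k::finite, 'r::finite, 'n::finite, 'q::finite) two_stage \<Rightarrow>
     's \<Rightarrow> 'j \<Rightarrow> (real ^ 'n) \<times> (real ^ 'q) \<Rightarrow> (('n \<times> 'n) + 'q) set" where
  "dual_tight P s j =
     linear_system.tight (dual_index (arcs P s j)) (dual_lhs P s j) (dual_rhs P s j)"

lemma linear_dual_obj: "linear (dual_obj P s j x)"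
  by (rule linearI)
    (auto simp: dual_obj_def split_beta inner_add_right distrib_left sum.distrib sum_distrib_left mult_ac)

lemma weak_duality:
  fixes P :: "('s::finite, 'j::finite, 'k::finite, 'r::finite, 'n::finite, 'q::finite) two_stage"
  assumes y: "y \<in> restricted_benders P s j E x" and d: "d \<in> dual_set P s j E"
  shows "dual_obj P s j x d \<le> (\<Sum>a\<in>E. cost2 P s j a * y a)"
proof -
  obtain \<psi> \<gamma> where d_eq: "d = (\<psi>, \<gamma>)" by (cases d)
  have off: "\<psi> $ n = 0" if "n \<notin> nodes P s j" for n
    using d that by (auto simp: d_eq dual_set_def)
  have \<gamma>: "0 \<le> \<gamma> $ q" for q
    using d by (auto simp: d_eq dual_set_def less_eq_vec_def)
  have le: "\<psi> $ m - \<psi> $ n + \<gamma> \<bullet> side_coef P (m, n) s j \<le> cost2 P s j (m, n)"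
    if "(m, n) \<in> E" for m n
    using d that by (auto simp: d_eq dual_set_def)
  have y0: "0 \<le> y a" if "a \<in> E" for a
    using y that by (auto simp: restricted_benders_def flows_def)
  have side: "side_rhs P s j \<le> (\<Sum>a\<in>E. y a *\<^sub>R side_coef P a s j)"
    using y by (auto simp: restricted_benders_def flows_def)
  have bal: "(\<Sum>m | (n, m) \<in> E. y (n, m)) - (\<Sum>m | (m, n) \<in> E. y (m, n)) = node_supply P s j x n"
    if "n \<in> nodes P s j" for n
    using y that by (auto simp: restricted_benders_def flows_def)
  \<comment> \<open>Summed over all nodes, the weighted flow balances become a sum over the arcs.\<close>
  have pairs: "(\<Sum>n\<in>UNIV. \<Sum>m\<in>UNIV. if (n, m) \<in> E then g n m else 0) = (\<Sum>(n, m)\<in>E. g n m)"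
    for g :: "'n \<Rightarrow> 'n \<Rightarrow> real"
    unfolding sum.cartesian_product by (rule sum.mono_neutral_cong_right) auto
  have "(\<Sum>n\<in>nodes P s j. \<Sum>k\<in>block P j. supply_coef P n s k * x $ k * \<psi> $ n) =
      (\<Sum>n\<in>nodes P s j. \<psi> $ n * node_supply P s j x n)"
    by (simp add: node_supply_def sum_distrib_left mult_ac)
  also have "\<dots> = (\<Sum>n\<in>nodes P s j. \<psi> $ n *
      ((\<Sum>m | (n, m) \<in> E. y (n, m)) - (\<Sum>m | (m, n) \<in> E. y (m, n))))"
    by (rule sum.cong) (simp_all add: bal)
  also have "\<dots> = (\<Sum>n\<in>UNIV. \<psi> $ n *
      ((\<Sum>m | (n, m) \<in> E. y (n, m)) - (\<Sum>m | (m, n) \<in> E. y (m, n))))"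
    by (rule sum.mono_neutral_left) (auto simp: off)
  also have "\<dots> = (\<Sum>n\<in>UNIV. \<Sum>m\<in>UNIV. if (n, m) \<in> E then \<psi> $ n * y (n, m) else 0) -
      (\<Sum>n\<in>UNIV. \<Sum>m\<in>UNIV. if (m, n) \<in> E then \<psi> $ n * y (m, n) else 0)"
    by (simp add: right_diff_distrib sum_subtractf sum_distrib_left sum.If_cases)
  also have "(\<Sum>n\<in>UNIV. \<Sum>m\<in>UNIV. if (m, n) \<in> E then \<psi> $ n * y (m, n) else 0) =
      (\<Sum>m\<in>UNIV. \<Sum>n\<in>UNIV. if (m, n) \<in> E then \<psi> $ n * y (m, n) else 0)"
    by (rule sum.swap)
  also have "(\<Sum>n\<in>UNIV. \<Sum>m\<in>UNIV. if (n, m) \<in> E then \<psi> $ n * y (n, m) else 0) - \<dots> =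
      (\<Sum>(m, n)\<in>E. y (m, n) * (\<psi> $ m - \<psi> $ n))"
    by (subst (1 2) pairs) (simp add: split_beta algebra_simps sum_subtractf)
  finally have flow: "(\<Sum>n\<in>nodes P s j. \<Sum>k\<in>block P j. supply_coef P n s k * x $ k * \<psi> $ n) =
      (\<Sum>(m, n)\<in>E. y (m, n) * (\<psi> $ m - \<psi> $ n))" .
  have "side_rhs P s j \<bullet> \<gamma> \<le> (\<Sum>a\<in>E. y a *\<^sub>R side_coef P a s j) \<bullet> \<gamma>"
    using side \<gamma> by (auto simp: inner_vec_def less_eq_vec_def intro!: sum_mono mult_right_mono)
  also have "\<dots> = (\<Sum>a\<in>E. y a * (\<gamma> \<bullet> side_coef P a s j))"
    by (simp add: inner_sum_left inner_commute[of \<gamma>])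
  finally have "dual_obj P s j x d \<le>
      (\<Sum>(m, n)\<in>E. y (m, n) * (\<psi> $ m - \<psi> $ n)) + (\<Sum>a\<in>E. y a * (\<gamma> \<bullet> side_coef P a s j))"
    using flow by (simp add: dual_obj_def d_eq)
  also have "\<dots> = (\<Sum>(m, n)\<in>E. y (m, n) * (\<psi> $ m - \<psi> $ n + \<gamma> \<bullet> side_coef P (m, n) s j))"
    by (simp add: sum.distrib[symmetric] split_beta distrib_left)
  also have "\<dots> \<le> (\<Sum>a\<in>E. cost2 P s j a * y a)"
    using le y0 by (auto intro!: sum_mono simp: mult.commute intro: mult_left_mono)
  finally show ?thesis .
qed

lemma dual_optimal_exists:
  assumes "restricted_benders P s j E x \<noteq> {}" "dual_set P s j E \<noteq> {}"
  shows "\<exists>d. dual_optimal P s j E x d"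
proof -
  obtain y where y: "y \<in> restricted_benders P s j E x" using assms(1) by auto
  show ?thesis
    using dual_system.attains_maximum[of "dual_obj P s j x" P s j E, unfolded dual_system_solutions,
        OF linear_dual_obj weak_duality[OF y] assms(2)]
    by (auto simp: dual_optimal_def)
qed

lemma ex_dual_extreme_above:
  assumes "restricted_benders P s j (arcs P s j) x \<noteq> {}" "d \<in> dual_set P s j (arcs P s j)"
  shows "\<exists>u\<in>dual_extreme P s j. dual_obj P s j x d \<le> dual_obj P s j x u"
proof -
  obtain y where y: "y \<in> restricted_benders P s j (arcs P s j) x" using assms(1) by auto
  show ?thesis
    using dual_system.ex_extreme_above[of "dual_obj P s j x" P s j "arcs P s j",
        unfolded dual_system_solutions, OF linear_dual_obj weak_duality[OF y] assms(2)]
    by (auto simp: dual_extreme_def)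
qed

lemma dual_extreme_subset: "dual_extreme P s j \<subseteq> dual_set P s j (arcs P s j)"
  by (auto simp: dual_extreme_def extreme_mod_lineality_def)

text \<open>
  The tight constraints determine an optimality cut at every \<open>x\<close> at which the Benders subproblem is
  feasible.
\<close>

lemma dual_extreme_obj_eq:
  assumes "restricted_benders P s j (arcs P s j) x \<noteq> {}"
    and "u \<in> dual_extreme P s j" "u' \<in> dual_extreme P s j"
    and "dual_tight P s j u = dual_tight P s j u'"
  shows "dual_obj P s j x u = dual_obj P s j x u'"
proof -
  obtain y where y: "y \<in> restricted_benders P s j (arcs P s j) x" using assms(1) by auto
  show ?thesis
    using assms(2-4) dual_extreme_subset[of P s j]
    by (intro dual_system.extreme_value_determined_by_tight[of "dual_obj P s j x" P s j "arcs P s j",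
        unfolded dual_system_solutions, OF linear_dual_obj weak_duality[OF y]])
      (auto simp: dual_extreme_def dual_tight_def)
qed

lemma reduced_cost_nonneg:
  "d \<in> dual_set P s j E \<Longrightarrow> a \<in> E \<Longrightarrow> 0 \<le> reduced_cost P s j d a"
  by (auto simp: dual_set_def reduced_cost_def split: prod.splits)

lemma dual_set_mono: "E \<subseteq> F \<Longrightarrow> dual_set P s j F \<subseteq> dual_set P s j E"
  by (auto simp: dual_set_def)

text \<open>
  The stopping test of column generation: a dual solution of the restricted problem without
  negative reduced cost is optimal for the full dual.
\<close>

lemma priced_out_dual_optimal:
  assumes "dual_optimal P s j E x d" "E \<subseteq> arcs P s j" "min_reduced_cost P s j d \<ge> 0"
  shows "dual_optimal P s j (arcs P s j) x d"
proof -
  have "0 \<le> reduced_cost P s j d a" if "a \<in> arcs P s j" for a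
    using assms(3) that by (auto simp: min_reduced_cost_def le_INF_iff)
  then have "d \<in> dual_set P s j (arcs P s j)"
    using assms(1) by (force simp: dual_optimal_def dual_set_def reduced_cost_def split: prod.splits)
  then show ?thesis
    using assms(1) dual_set_mono[OF assms(2)] by (fastforce simp: dual_optimal_def)
qed

lemma restricted_benders_mono:
  assumes "E \<subseteq> F" "restricted_benders P s j E x \<noteq> {}"
  shows "restricted_benders P s j F x \<noteq> {}"
proof -
  obtain y where y: "y \<in> restricted_benders P s j E x" using assms by auto
  \<comment> \<open>Values off \<open>E\<close> are arbitrary in \<open>y\<close>, so they are reset to zero.\<close>
  define y' where "y' a = (if a \<in> E then y a else 0)" for a
  have out: "(\<Sum>m | (n, m) \<in> F. y' (n, m)) = (\<Sum>m | (n, m) \<in> E. y (n, m))" for n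
    using assms(1) by (intro sum.mono_neutral_cong_right) (auto simp: y'_def)
  have inn: "(\<Sum>m | (m, n) \<in> F. y' (m, n)) = (\<Sum>m | (m, n) \<in> E. y (m, n))" for n
    using assms(1) by (intro sum.mono_neutral_cong_right) (auto simp: y'_def)
  have side: "(\<Sum>a\<in>F. y' a *\<^sub>R side_coef P a s j) = (\<Sum>a\<in>E. y a *\<^sub>R side_coef P a s j)"
    using assms(1) by (intro sum.mono_neutral_cong_right) (auto simp: y'_def)
  have "y' \<in> restricted_benders P s j F x"
    using y unfolding restricted_benders_def flows_def mem_Collect_eq out inn side
    by (auto simp: y'_def)
  then show ?thesis by auto
qed

section \<open>Validity of the cuts\<close>

locale binary_recourse_problem =
  fixes P :: "('s::finite, 'j::finite, 'k::finite, 'r::finite, 'n::finite, 'q::finite) two_stage"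
    and \<Phi> :: "'s \<Rightarrow> 'j \<Rightarrow> real"
  assumes valid: "valid_data P"
    and binary: "X_MIO P = {x. \<forall>k. x $ k \<in> {0, 1}}"
    and recourse: "relatively_complete_recourse P"
    and attained: "second_stage_attained P"
    and lower_bound: "global_lower_bound P \<Phi>"
    and dual_nonempty: "\<And>s j. dual_set P s j (arcs P s j) \<noteq> {}"
begin

lemma prob_nonneg: "0 \<le> prob P s"
  using valid by (simp add: valid_data_def)

lemma first_stage_binary: "x \<in> first_stage P \<Longrightarrow> x $ k = 0 \<or> x $ k = 1"
  using binary by (auto simp: first_stage_def)

lemma finite_first_stage: "finite (first_stage P)"
proof (rule finite_subset)
  show "first_stage P \<subseteq> vec_lambda ` (UNIV \<rightarrow>\<^sub>E {0, 1})"
  proof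
    fix x assume "x \<in> first_stage P"
    then have "($) x \<in> UNIV \<rightarrow>\<^sub>E {0, 1}" using first_stage_binary by auto
    then show "x \<in> vec_lambda ` (UNIV \<rightarrow>\<^sub>E {0, 1})"
      by (metis image_eqI vec_nth_inverse)
  qed
qed (simp add: finite_PiE)

lemma second_stage_optimal_exists:
  assumes "x \<in> first_stage P"
  obtains y where "second_stage_optimal P s j x y"
  using assms recourse attained
  unfolding relatively_complete_recourse_def second_stage_attained_def by blast

lemma second_stage_value_eq:
  assumes "second_stage_optimal P s j x y"
  shows "second_stage_value P s j x = flow_cost P s j y"
  unfolding second_stage_value_def
  using assms by (intro cInf_eq_minimum) (auto simp: second_stage_optimal_def)

lemma second_stage_value_le:
  assumes "x \<in> first_stage P" "y \<in> second_stage P s j x"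
  shows "second_stage_value P s j x \<le> flow_cost P s j y"
proof -
  obtain y0 where y0: "second_stage_optimal P s j x y0"
    using second_stage_optimal_exists[OF assms(1)] .
  then show ?thesis
    using assms(2) by (simp add: second_stage_value_eq[OF y0] second_stage_optimal_def)
qed

lemma second_stage_subset_benders:
  "second_stage P s j x \<subseteq> restricted_benders P s j (arcs P s j) x"
proof -
  have "Y_MIO P s j a \<subseteq> {0..}" if "a \<in> arcs P s j" for a
    using valid that unfolding valid_data_def by blast
  then show ?thesis unfolding second_stage_def restricted_benders_def flows_def by blast
qed

lemma benders_feasible:
  "x \<in> first_stage P \<Longrightarrow> restricted_benders P s j (arcs P s j) x \<noteq> {}"
  using recourse second_stage_subset_benders unfolding relatively_complete_recourse_def
  by (metis subset_empty)

lemma benders_cut_valid: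
  assumes "x \<in> first_stage P" "u \<in> dual_set P s j (arcs P s j)"
  shows "dual_obj P s j x u \<le> second_stage_value P s j x"
proof -
  obtain y where y: "second_stage_optimal P s j x y"
    using second_stage_optimal_exists[OF assms(1)] .
  then have "y \<in> restricted_benders P s j (arcs P s j) x"
    using second_stage_subset_benders by (auto simp: second_stage_optimal_def)
  from weak_duality[OF this assms(2)] show ?thesis
    by (simp add: second_stage_value_eq[OF y] flow_cost_def)
qed

lemma second_stage_value_block_cong:
  assumes "\<And>k. k \<in> block P j \<Longrightarrow> w $ k = x $ k"
  shows "second_stage_value P s j w = second_stage_value P s j x"
proof -
  have "node_supply P s j w n = node_supply P s j x n" for n
    using assms by (simp add: node_supply_def)
  then show ?thesis by (simp add: second_stage_value_def second_stage_def flows_def)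
qed

text \<open>
  The sums in the integer L-shaped cut of \<open>w\<close> count the indices of the block at which the binary
  points \<open>x\<close> and \<open>w\<close> differ. So the right-hand side is the value at \<open>w\<close> if there are none, and at
  most the global lower bound otherwise.
\<close>

lemma L_shaped_bound_at_self:
  "L_shaped_bound P \<Phi> s j w w = second_stage_value P s j w"
  by (simp add: L_shaped_bound_def)

lemma L_shaped_cut_valid:
  assumes x: "x \<in> first_stage P" and w: "w \<in> first_stage P"
  shows "L_shaped_bound P \<Phi> s j w x \<le> second_stage_value P s j x"
proof -
  define A where "A = {k. k \<in> block P j \<and> w $ k = 1}"
  define B where "B = {k. k \<in> block P j \<and> w $ k = 0}"
  define D where "D = (\<Sum>k\<in>A. 1 - x $ k) + (\<Sum>k\<in>B. x $ k)"
  have bound: "L_shaped_bound P \<Phi> s j w x = \<Phi> s j + (second_stage_value P s j w - \<Phi> s j) * (1 - D)"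
    by (simp add: L_shaped_bound_def D_def A_def B_def algebra_simps)
  have x01: "0 \<le> x $ k" "x $ k \<le> 1" for k using first_stage_binary[OF x, of k] by auto
  have lb: "\<Phi> s j \<le> second_stage_value P s j w" "\<Phi> s j \<le> second_stage_value P s j x"
    using lower_bound x w by (auto simp: global_lower_bound_def)
  show ?thesis
  proof (cases "\<forall>k\<in>block P j. w $ k = x $ k")
    case True
    then have "(\<Sum>k\<in>A. 1 - x $ k) = 0" "(\<Sum>k\<in>B. x $ k) = 0"
      by (auto simp: A_def B_def intro!: sum.neutral)
    then have "D = 0" by (simp add: D_def)
    then show ?thesis using bound second_stage_value_block_cong[of j w x s] True by simp
  next
    case False
    then obtain k where k: "k \<in> block P j" "w $ k \<noteq> x $ k" by auto
    have nonneg: "0 \<le> (\<Sum>k\<in>A. 1 - x $ k)" "0 \<le> (\<Sum>k\<in>B. x $ k)"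
      using x01 by (auto intro!: sum_nonneg)
    have "D \<ge> 1"
    proof (cases "w $ k = 1")
      case True
      then have "1 - x $ k \<le> (\<Sum>k\<in>A. 1 - x $ k)"
        using k x01 by (intro member_le_sum) (auto simp: A_def)
      moreover have "x $ k = 0" using True k first_stage_binary[OF x, of k] by auto
      ultimately have "1 \<le> (\<Sum>k\<in>A. 1 - x $ k)" by simp
      then show ?thesis using nonneg by (simp add: D_def)
    next
      case False
      then have w0: "w $ k = 0" using first_stage_binary[OF w, of k] by simp
      then have "x $ k \<le> (\<Sum>k\<in>B. x $ k)"
        using k x01 by (intro member_le_sum) (auto simp: B_def)
      moreover have "x $ k = 1" using w0 k first_stage_binary[OF x, of k] by auto
      ultimately have "1 \<le> (\<Sum>k\<in>B. x $ k)" by simp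
      then show ?thesis using nonneg by (simp add: D_def)
    qed
    then have "(second_stage_value P s j w - \<Phi> s j) * (1 - D) \<le> 0"
      using lb by (intro mult_nonneg_nonpos) auto
    then show ?thesis using bound lb by linarith
  qed
qed

section \<open>The master problem\<close>

text \<open>The cost of the two-stage problem as a function of the first-stage solution alone.\<close>

definition objective :: "real ^ 'k \<Rightarrow> real" where
  "objective x = first_cost P x + (\<Sum>s\<in>UNIV. \<Sum>j\<in>UNIV. prob P s * second_stage_value P s j x)"

lemma problem_cost_eq_objective:
  assumes "\<And>s j. second_stage_optimal P s j x (y s j)"
  shows "problem_cost P (x, y) = objective x"
  by (simp add: problem_cost_def objective_def second_stage_value_eq[OF assms])

lemma objective_le_problem_cost:
  assumes "(x, y) \<in> problem_feasible P"
  shows "objective x \<le> problem_cost P (x, y)"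
  using assms prob_nonneg
  by (auto simp: problem_cost_def objective_def problem_feasible_def
      intro!: sum_mono mult_left_mono second_stage_value_le)

lemma problem_feasible_empty_iff: "problem_feasible P = {} \<longleftrightarrow> first_stage P = {}"
proof
  assume empty: "problem_feasible P = {}"
  have False if x: "x \<in> first_stage P" for x
  proof -
    have "\<forall>s j. \<exists>y. y \<in> second_stage P s j x"
      using recourse x unfolding relatively_complete_recourse_def by blast
    then obtain y where "\<And>s j. y s j \<in> second_stage P s j x" by metis
    then have "(x, y) \<in> problem_feasible P" using x by (simp add: problem_feasible_def)
    then show False using empty by simp
  qed
  then show "first_stage P = {}" by auto
qed (auto simp: problem_feasible_def)

lemma objective_eq_master_cost_plus_gap:
  "objective x = master_cost P (x, \<theta>) + gap P x \<theta>"
  by (simp add: objective_def master_cost_def gap_def sum_distrib_left right_diff_distrib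
      sum_subtractf)

text \<open>
  Finitely many optimality cuts from dual extreme points and L-shaped cuts from feasible points,
  with a master problem that is bounded below.
\<close>

definition admissible_cuts ::
    "('s \<Rightarrow> 'j \<Rightarrow> ((real ^ 'n) \<times> (real ^ 'q)) set) \<Rightarrow> (real ^ 'k) list \<Rightarrow> bool" where
  "admissible_cuts U W \<longleftrightarrow>
     (\<forall>s j. finite (U s j) \<and> U s j \<subseteq> dual_extreme P s j) \<and> set W \<subseteq> first_stage P \<and>
     bdd_below (master_cost P ` master_feasible P \<Phi> U W)"

lemma master_feasible_antimono:
  assumes "\<And>s j. U s j \<subseteq> U' s j" "set W \<subseteq> set W'"
  shows "master_feasible P \<Phi> U' W' \<subseteq> master_feasible P \<Phi> U W"
  using assms unfolding master_feasible_def by blast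

lemma admissible_cuts_extend:
  assumes "admissible_cuts U W" "\<And>s j. U s j \<subseteq> U' s j" "set W \<subseteq> set W'"
    and "\<And>s j. finite (U' s j)" "\<And>s j. U' s j \<subseteq> dual_extreme P s j" "set W' \<subseteq> first_stage P"
  shows "admissible_cuts U' W'"
proof -
  have "bdd_below (master_cost P ` master_feasible P \<Phi> U' W')"
    using assms(1) image_mono[OF master_feasible_antimono[of U U' W W', OF assms(2,3)]]
    unfolding admissible_cuts_def by (meson bdd_below_mono)
  then show ?thesis using assms(4-6) by (auto simp: admissible_cuts_def)
qed

lemma value_master_feasible:
  assumes "admissible_cuts U W" "x \<in> first_stage P"
  shows "(x, \<lambda>s j. second_stage_value P s j x) \<in> master_feasible P \<Phi> U W"
proof -
  have "dual_obj P s j x u \<le> second_stage_value P s j x" if "u \<in> U s j" for s j u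
  proof -
    have "u \<in> dual_set P s j (arcs P s j)"
      using assms(1) that dual_extreme_subset[of P s j] by (auto simp: admissible_cuts_def)
    then show ?thesis using benders_cut_valid[OF assms(2)] by auto
  qed
  moreover have "L_shaped_bound P \<Phi> s j w x \<le> second_stage_value P s j x" if "w \<in> set W" for s j w
    using assms that by (intro L_shaped_cut_valid) (auto simp: admissible_cuts_def)
  ultimately show ?thesis using assms(2) by (auto simp: master_feasible_def)
qed

lemma master_cost_le_objective:
  assumes "admissible_cuts U W" "master_optimal P \<Phi> U W (x, \<theta>)" "x' \<in> first_stage P"
  shows "master_cost P (x, \<theta>) \<le> objective x'"
proof -
  have "master_cost P (x, \<theta>) \<le> master_cost P (x', \<lambda>s j. second_stage_value P s j x')"
    using assms(2) value_master_feasible[OF assms(1,3)] unfolding master_optimal_def by blast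
  then show ?thesis by (simp add: master_cost_def objective_def)
qed

text \<open>
  For fixed \<open>x\<close>, each \<open>\<theta> s j\<close> is lowered to the largest of its cuts. If there is none, then either
  scenario \<open>s\<close> has probability zero or the master problem is unbounded.
\<close>

lemma master_optimal_exists:
  assumes adm: "admissible_cuts U W" and ne: "first_stage P \<noteq> {}"
  shows "\<exists>z. master_optimal P \<Phi> U W z"
proof -
  define C where "C x s j = (\<lambda>u. dual_obj P s j x u) ` U s j \<union> (\<lambda>w. L_shaped_bound P \<Phi> s j w x) ` set W"
    for x s j
  have finC: "finite (C x s j)" for x s j using adm by (auto simp: C_def admissible_cuts_def)
  have feas: "(x, \<theta>) \<in> master_feasible P \<Phi> U W \<longleftrightarrow>
      x \<in> first_stage P \<and> (\<forall>s j. \<forall>c\<in>C x s j. c \<le> \<theta> s j)" for x \<theta>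
    by (auto simp: master_feasible_def C_def)
  define T where "T x s j = (if C x s j = {} then 0 else Max (C x s j))" for x s j
  have T_feas: "(x, T x) \<in> master_feasible P \<Phi> U W" if "x \<in> first_stage P" for x
    using that finC by (auto simp: feas T_def)
  obtain B where B: "\<And>z. z \<in> master_feasible P \<Phi> U W \<Longrightarrow> B \<le> master_cost P z"
    using adm unfolding admissible_cuts_def bdd_below_def by blast
  \<comment> \<open>A variable without cuts and with positive weight could be decreased below the bound \<open>B\<close>.\<close>
  have zero: "prob P s0 = 0" if x: "x \<in> first_stage P" and empty: "C x s0 j0 = {}" for x s0 j0
  proof (rule ccontr)
    assume "prob P s0 \<noteq> 0"
    then have p: "prob P s0 > 0" using prob_nonneg[of s0] by simp
    define t where "t = (master_cost P (x, T x) - B + 1) / prob P s0"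
    define \<theta> where "\<theta> s j = T x s j - (if s = s0 then if j = j0 then t else 0 else 0)" for s j
    have "(x, \<theta>) \<in> master_feasible P \<Phi> U W"
      using T_feas[OF x] empty by (auto simp: feas \<theta>_def)
    then have "B \<le> master_cost P (x, \<theta>)" by (rule B)
    moreover have "(\<Sum>j\<in>UNIV. prob P s * (if s = s0 then if j = j0 then t else 0 else 0)) =
        (if s = s0 then prob P s0 * t else 0)" for s
      by (simp add: sum_distrib_left[symmetric])
    then have "master_cost P (x, \<theta>) = master_cost P (x, T x) - prob P s0 * t"
      by (simp add: master_cost_def \<theta>_def right_diff_distrib sum_subtractf)
    moreover have "prob P s0 * t = master_cost P (x, T x) - B + 1"
      using p by (simp add: t_def)
    ultimately show False by linarith
  qed
  have T_best: "master_cost P (x, T x) \<le> master_cost P (x, \<theta>)"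
    if m: "(x, \<theta>) \<in> master_feasible P \<Phi> U W" for x \<theta>
  proof -
    have "prob P s * T x s j \<le> prob P s * \<theta> s j" for s j
    proof (cases "C x s j = {}")
      case True
      then show ?thesis using zero[of x s j] m by (simp add: feas)
    next
      case False
      then have "T x s j \<le> \<theta> s j" using m finC by (simp add: feas T_def)
      then show ?thesis using prob_nonneg by (rule mult_left_mono)
    qed
    then show ?thesis by (auto simp: master_cost_def intro!: sum_mono)
  qed
  define x where "x = arg_min_on (\<lambda>x. master_cost P (x, T x)) (first_stage P)"
  have x: "x \<in> first_stage P" "\<And>x'. x' \<in> first_stage P \<Longrightarrow> master_cost P (x, T x) \<le> master_cost P (x', T x')"
    unfolding x_def using arg_min_if_finite(1)[OF finite_first_stage ne]
      arg_min_least[OF finite_first_stage ne, of _ "\<lambda>x. master_cost P (x, T x)"] by auto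
  have "master_cost P (x, T x) \<le> master_cost P (x', \<theta>)"
    if "(x', \<theta>) \<in> master_feasible P \<Phi> U W" for x' \<theta>
    using x(2)[of x'] T_best[OF that] that by (auto simp: feas)
  then show ?thesis
    using T_feas[OF x(1)] unfolding master_optimal_def by (intro exI[of _ "(x, T x)"]) auto
qed

lemma master_feasible_empty_iff:
  assumes "admissible_cuts U W"
  shows "master_feasible P \<Phi> U W = {} \<longleftrightarrow> first_stage P = {}"
proof
  show "first_stage P = {}" if "master_feasible P \<Phi> U W = {}"
    using value_master_feasible[OF assms] that by blast
qed (auto simp: master_feasible_def)

section \<open>Runs of the algorithm\<close>

text \<open>
  What holds in each state of a run. The data of the master problem are kept until a solution is
  returned, which then costs less than \<open>\<epsilon>\<close> more than every feasible one.
\<close>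

fun run_invariant :: "real \<Rightarrow> ('s, 'j, 'k, 'n, 'q) dd_ils_state \<Rightarrow> bool" where
  "run_invariant \<epsilon> (Master U W) \<longleftrightarrow> admissible_cuts U W"
| "run_invariant \<epsilon> (Column_generation U W x \<theta> E) \<longleftrightarrow>
     admissible_cuts U W \<and> master_optimal P \<Phi> U W (x, \<theta>) \<and>
     (\<forall>s j. E s j \<subseteq> arcs P s j \<and> restricted_benders P s j (E s j) x \<noteq> {})"
| "run_invariant \<epsilon> (Integer U W x \<theta>) \<longleftrightarrow>
     admissible_cuts U W \<and> master_optimal P \<Phi> U W (x, \<theta>)"
| "run_invariant \<epsilon> Infeasible \<longleftrightarrow> first_stage P = {}"
| "run_invariant \<epsilon> (Returned x y) \<longleftrightarrow>
     x \<in> first_stage P \<and> (\<forall>s j. second_stage_optimal P s j x (y s j)) \<and>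
     (\<forall>x'\<in>first_stage P. objective x < objective x' + \<epsilon>)"

lemma master_optimal_first_stage: "master_optimal P \<Phi> U W (x, \<theta>) \<Longrightarrow> x \<in> first_stage P"
  by (simp add: master_optimal_def master_feasible_def)

lemma run_invariant_initial: "dd_ils_initial P \<Phi> st \<Longrightarrow> run_invariant \<epsilon> st"
  by (auto simp: dd_ils_initial_def admissible_cuts_def)

lemma column_generation_extends:
  assumes "\<And>s j. if min_reduced_cost P s j (d s j) < 0
              then \<exists>a\<in>arcs P s j. ereal (reduced_cost P s j (d s j) a) = min_reduced_cost P s j (d s j) \<and>
                                  E' s j = insert a (E s j)
              else E' s j = E s j"
  shows "E s j \<subseteq> E' s j" "E s j \<subseteq> arcs P s j \<Longrightarrow> E' s j \<subseteq> arcs P s j"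
  using assms[of s j] by (auto split: if_splits)

lemma run_invariant_step:
  assumes "dd_ils_step P \<Phi> \<epsilon> st st'" "run_invariant \<epsilon> st"
  shows "run_invariant \<epsilon> st'"
  using assms
proof (induction rule: dd_ils_step.induct)
  case (master_infeasible U W)
  then show ?case using master_feasible_empty_iff by simp
next
  case (master_solved U W x \<theta> E)
  then show ?case by simp
next
  case (generate_columns E x d E' U W \<theta>)
  have "E' s j \<subseteq> arcs P s j \<and> restricted_benders P s j (E' s j) x \<noteq> {}" for s j
    using column_generation_extends[OF generate_columns(3), of s j] generate_columns(4)
      restricted_benders_mono[of "E s j" "E' s j" P s j x] by auto
  then show ?case using generate_columns(4) by simp
next
  case (add_benders_cuts E x d u \<theta> U W)
  define U' where
    "U' s j = (if \<theta> s j < dual_obj P s j x (u s j) then insert (u s j) (U s j) else U s j)" for s j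
  have adm: "admissible_cuts U W" using add_benders_cuts by simp
  have "admissible_cuts U' W"
    using adm add_benders_cuts(3)
    by (intro admissible_cuts_extend[OF adm]) (auto simp: U'_def admissible_cuts_def)
  then show ?case by (simp add: U'_def[abs_def])
next
  case (benders_converged E x d u \<theta> U W)
  then show ?case by simp
next
  case (gap_closed x y \<theta> U W)
  have "objective x < objective x' + \<epsilon>" if "x' \<in> first_stage P" for x'
    using master_cost_le_objective[of U W x \<theta> x'] objective_eq_master_cost_plus_gap[of x \<theta>]
      gap_closed that by simp
  then show ?case using gap_closed master_optimal_first_stage by auto
next
  case (add_L_shaped_cuts x \<theta> U W)
  then have adm: "admissible_cuts U W" and x: "x \<in> first_stage P"
    using master_optimal_first_stage by auto
  have "admissible_cuts U (W @ [x])"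
    using adm x by (intro admissible_cuts_extend[OF adm]) (auto simp: admissible_cuts_def)
  then show ?case by simp
qed

lemma run_continues:
  assumes inv: "run_invariant \<epsilon> st" and not_terminal: "st \<noteq> Infeasible" "\<nexists>x y. st = Returned x y"
  shows "\<exists>st'. dd_ils_step P \<Phi> \<epsilon> st st'"
proof (cases st)
  case (Master U W)
  show ?thesis
  proof (cases "first_stage P = {}")
    case True
    then have "master_feasible P \<Phi> U W = {}"
      using inv Master master_feasible_empty_iff by simp
    then show ?thesis unfolding Master using dd_ils_step.master_infeasible by blast
  next
    case False
    then obtain x \<theta> where opt: "master_optimal P \<Phi> U W (x, \<theta>)"
      using master_optimal_exists[of U W] inv Master by auto
    have "restricted_benders P s j (arcs P s j) x \<noteq> {}" for s j
      by (rule benders_feasible[OF master_optimal_first_stage[OF opt]])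
    then have "dd_ils_step P \<Phi> \<epsilon> st (Column_generation U W x \<theta> (arcs P))"
      unfolding Master by (intro dd_ils_step.master_solved opt) auto
    then show ?thesis by blast
  qed
next
  case (Column_generation U W x \<theta> E)
  have x: "x \<in> first_stage P"
    using inv Column_generation master_optimal_first_stage by auto
  have E: "E s j \<subseteq> arcs P s j" "restricted_benders P s j (E s j) x \<noteq> {}" for s j
    using inv Column_generation by auto
  have "\<exists>d. dual_optimal P s j (E s j) x d" for s j
  proof (rule dual_optimal_exists[OF E(2)])
    show "dual_set P s j (E s j) \<noteq> {}"
      using dual_set_mono[OF E(1)[of s j], of P s j] dual_nonempty[of s j] by auto
  qed
  then obtain d where d: "\<And>s j. dual_optimal P s j (E s j) x (d s j)" by metis
  show ?thesis
  proof (cases "\<exists>s j. min_reduced_cost P s j (d s j) < 0")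
    case True
    have "\<exists>a\<in>arcs P s j. ereal (reduced_cost P s j (d s j) a) = min_reduced_cost P s j (d s j)"
      if "min_reduced_cost P s j (d s j) < 0" for s j
    proof -
      let ?R = "(\<lambda>a. ereal (reduced_cost P s j (d s j) a)) ` arcs P s j"
      have ne: "arcs P s j \<noteq> {}" using that by (auto simp: min_reduced_cost_def top_ereal_def)
      then have "Min ?R \<in> ?R" by (intro Min_in) auto
      moreover have "min_reduced_cost P s j (d s j) = Min ?R"
        unfolding min_reduced_cost_def using ne by (subst Min_Inf) auto
      ultimately have "min_reduced_cost P s j (d s j) \<in> ?R" by (simp only:)
      then show ?thesis
      proof (rule imageE)
        fix a assume a: "a \<in> arcs P s j"
          and eq: "min_reduced_cost P s j (d s j) = ereal (reduced_cost P s j (d s j) a)"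
        show ?thesis by (rule bexI[OF _ a], rule eq[symmetric])
      qed
    qed
    then have "\<forall>s j. \<exists>a. min_reduced_cost P s j (d s j) < 0 \<longrightarrow> a \<in> arcs P s j \<and>
        ereal (reduced_cost P s j (d s j) a) = min_reduced_cost P s j (d s j)"
      by blast
    then obtain entering where entering: "\<And>s j. min_reduced_cost P s j (d s j) < 0 \<Longrightarrow>
        entering s j \<in> arcs P s j \<and>
        ereal (reduced_cost P s j (d s j) (entering s j)) = min_reduced_cost P s j (d s j)"
      unfolding choice_iff by blast
    define E' where "E' s j = (if min_reduced_cost P s j (d s j) < 0
        then insert (entering s j) (E s j) else E s j)" for s j
    have E': "if min_reduced_cost P s j (d s j) < 0
        then \<exists>a\<in>arcs P s j. ereal (reduced_cost P s j (d s j) a) = min_reduced_cost P s j (d s j) \<and>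
                            E' s j = insert a (E s j)
        else E' s j = E s j" for s j
    proof (cases "min_reduced_cost P s j (d s j) < 0")
      case True
      show ?thesis
        unfolding if_P[OF True]
      proof (intro bexI conjI)
        show "E' s j = insert (entering s j) (E s j)" using True by (simp add: E'_def)
      qed (simp_all add: entering[OF True])
    qed (simp add: E'_def)
    show ?thesis
      unfolding Column_generation using dd_ils_step.generate_columns[OF d True E'] by (rule exI)
  next
    case False
    then have rc: "\<And>s j. min_reduced_cost P s j (d s j) \<ge> 0" by (simp add: not_less)
    have "\<exists>u\<in>dual_extreme P s j. dual_obj P s j x u = dual_obj P s j x (d s j)" for s j
    proof -
      have opt: "dual_optimal P s j (arcs P s j) x (d s j)"
        using priced_out_dual_optimal[OF d E(1) rc] .
      then obtain u where "u \<in> dual_extreme P s j" "dual_obj P s j x (d s j) \<le> dual_obj P s j x u"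
        using ex_dual_extreme_above[OF benders_feasible[OF x]] unfolding dual_optimal_def by metis
      moreover from this(1) have "dual_obj P s j x u \<le> dual_obj P s j x (d s j)"
        using opt dual_extreme_subset unfolding dual_optimal_def by blast
      ultimately show ?thesis using antisym by blast
    qed
    then obtain u where u: "\<And>s j. u s j \<in> dual_extreme P s j"
        "\<And>s j. dual_obj P s j x (u s j) = dual_obj P s j x (d s j)"
      by metis
    show ?thesis
    proof (cases "\<exists>s j. \<theta> s j < dual_obj P s j x (u s j)")
      case True
      show ?thesis
        unfolding Column_generation using dd_ils_step.add_benders_cuts[OF d rc u True] by (rule exI)
    next
      case False
      then have "\<And>s j. \<theta> s j \<ge> dual_obj P s j x (u s j)" by (simp add: not_less)
      from dd_ils_step.benders_converged[OF d rc u this] show ?thesis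
        unfolding Column_generation by (rule exI)
    qed
  qed
next
  case (Integer U W x \<theta>)
  have x: "x \<in> first_stage P"
    using inv Integer master_optimal_first_stage by auto
  have "\<forall>s j. \<exists>y. second_stage_optimal P s j x y"
    using second_stage_optimal_exists[OF x] by metis
  then obtain y where y: "\<And>s j. second_stage_optimal P s j x (y s j)" by metis
  show ?thesis
  proof (cases "gap P x \<theta> < \<epsilon>")
    case True
    then show ?thesis unfolding Integer using dd_ils_step.gap_closed[OF y] by blast
  next
    case False
    then show ?thesis unfolding Integer using dd_ils_step.add_L_shaped_cuts by (meson not_less)
  qed
next
  case Infeasible
  then show ?thesis using not_terminal by simp
next
  case (Returned x y)
  then show ?thesis using not_terminal by simp
qed

section \<open>Termination\<close>

text \<open>
  A bound on the number of cuts still to come: the sets of tight constraints not yet represented by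
  an optimality cut, and the first-stage solutions not yet visited.
\<close>

definition cuts_left ::
    "('s \<Rightarrow> 'j \<Rightarrow> ((real ^ 'n) \<times> (real ^ 'q)) set) \<Rightarrow> (real ^ 'k) list \<Rightarrow> nat" where
  "cuts_left U W = (\<Sum>s\<in>UNIV. \<Sum>j\<in>UNIV. card (- dual_tight P s j ` U s j)) +
     card (first_stage P - set W)"

fun state_cuts_left :: "('s, 'j, 'k, 'n, 'q) dd_ils_state \<Rightarrow> nat" where
  "state_cuts_left (Master U W) = cuts_left U W"
| "state_cuts_left (Column_generation U W x \<theta> E) = cuts_left U W"
| "state_cuts_left (Integer U W x \<theta>) = cuts_left U W"
| "state_cuts_left _ = 0"

text \<open>
  Decreases in every step that adds no cut: it drops by the number of entering arcs in column
  generation, and the constants order the stages.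
\<close>

fun stage_rank :: "('s, 'j, 'k, 'n, 'q) dd_ils_state \<Rightarrow> nat" where
  "stage_rank (Master U W) = (\<Sum>s\<in>UNIV. \<Sum>j\<in>UNIV. card (arcs P s j)) + 3"
| "stage_rank (Column_generation U W x \<theta> E) =
     (\<Sum>s\<in>UNIV. \<Sum>j\<in>UNIV. card (arcs P s j - E s j)) + 2"
| "stage_rank (Integer U W x \<theta>) = 1"
| "stage_rank _ = 0"

lemma double_sum_strict_mono:
  fixes f g :: "'s \<Rightarrow> 'j \<Rightarrow> nat"
  assumes "\<And>s j. f s j \<le> g s j" "f s0 j0 < g s0 j0"
  shows "(\<Sum>s\<in>UNIV. \<Sum>j\<in>UNIV. f s j) < (\<Sum>s\<in>UNIV. \<Sum>j\<in>UNIV. g s j)"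
proof -
  have "(\<Sum>j\<in>UNIV. f s0 j) < (\<Sum>j\<in>UNIV. g s0 j)"
    using assms by (intro sum_strict_mono_ex1) auto
  then show ?thesis
    using assms(1) by (intro sum_strict_mono_ex1) (auto intro!: sum_mono)
qed

text \<open>
  An entering arc has negative reduced cost and so cannot belong to the restricted arc set already.
\<close>

lemma column_generation_decreases:
  assumes "run_invariant \<epsilon> (Column_generation U W x \<theta> E)"
    and d: "\<And>s j. dual_optimal P s j (E s j) x (d s j)"
    and neg: "\<exists>s j. min_reduced_cost P s j (d s j) < 0"
    and E': "\<And>s j. if min_reduced_cost P s j (d s j) < 0
              then \<exists>a\<in>arcs P s j. ereal (reduced_cost P s j (d s j) a) = min_reduced_cost P s j (d s j) \<and>
                                  E' s j = insert a (E s j)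
              else E' s j = E s j"
  shows "stage_rank (Column_generation U W x \<theta> E') < stage_rank (Column_generation U W x \<theta> E)"
proof -
  obtain s0 j0 where neg0: "min_reduced_cost P s0 j0 (d s0 j0) < 0" using neg by auto
  then obtain a where a: "a \<in> arcs P s0 j0" "E' s0 j0 = insert a (E s0 j0)"
      "ereal (reduced_cost P s0 j0 (d s0 j0) a) = min_reduced_cost P s0 j0 (d s0 j0)"
    using E'[of s0 j0] by auto
  have "ereal (reduced_cost P s0 j0 (d s0 j0) a) < 0" using a(3) neg0 by simp
  then have "a \<notin> E s0 j0"
    using reduced_cost_nonneg[of "d s0 j0" P s0 j0 "E s0 j0" a] d[of s0 j0]
    by (auto simp: dual_optimal_def)
  then have "card (arcs P s0 j0 - E' s0 j0) < card (arcs P s0 j0 - E s0 j0)"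
    using a by (intro psubset_card_mono) auto
  moreover have "card (arcs P s j - E' s j) \<le> card (arcs P s j - E s j)" for s j
    using column_generation_extends(1)[OF E', of s j] by (intro card_mono) auto
  ultimately show ?thesis
    using double_sum_strict_mono[of "\<lambda>s j. card (arcs P s j - E' s j)"
        "\<lambda>s j. card (arcs P s j - E s j)" s0 j0] by simp
qed

text \<open>
  A cut violated by \<open>(x, \<theta>)\<close> has a larger value at \<open>x\<close> than all present ones, hence a new set of
  tight constraints.
\<close>

lemma violated_cut_new_tight:
  assumes adm: "admissible_cuts U W" and opt: "master_optimal P \<Phi> U W (x, \<theta>)"
    and u: "u \<in> dual_extreme P s j" and violated: "\<theta> s j < dual_obj P s j x u"
  shows "dual_tight P s j u \<notin> dual_tight P s j ` U s j"
proof
  assume "dual_tight P s j u \<in> dual_tight P s j ` U s j"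
  then obtain u' where u': "u' \<in> U s j" "dual_tight P s j u = dual_tight P s j u'" by auto
  then have "dual_obj P s j x u = dual_obj P s j x u'"
    using adm u benders_feasible[OF master_optimal_first_stage[OF opt]]
    unfolding admissible_cuts_def by (intro dual_extreme_obj_eq) blast+
  moreover have "dual_obj P s j x u' \<le> \<theta> s j"
    using opt u' by (auto simp: master_optimal_def master_feasible_def)
  ultimately show False using violated by simp
qed

text \<open>At a visited point the L-shaped cuts force \<open>\<theta>\<close> up to the second-stage values.\<close>

lemma gap_at_visited_nonpos:
  assumes "master_optimal P \<Phi> U W (x, \<theta>)" "x \<in> set W"
  shows "gap P x \<theta> \<le> 0"
proof -
  have "L_shaped_bound P \<Phi> s j x x \<le> \<theta> s j" for s j
    using assms by (simp add: master_optimal_def master_feasible_def)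
  then have "second_stage_value P s j x \<le> \<theta> s j" for s j
    by (simp add: L_shaped_bound_at_self)
  then show ?thesis
    unfolding gap_def by (intro sum_nonpos mult_nonneg_nonpos prob_nonneg) simp
qed

lemma step_decreases:
  assumes "dd_ils_step P \<Phi> \<epsilon> st st'" "run_invariant \<epsilon> st" and \<epsilon>: "\<epsilon> > 0"
  shows "(st', st) \<in> measures [state_cuts_left, stage_rank]"
  using assms(1,2)
proof (induction rule: dd_ils_step.induct)
  case (master_infeasible U W)
  then show ?case by auto
next
  case (master_solved U W x \<theta> E)
  have "(\<Sum>s\<in>UNIV. \<Sum>j\<in>UNIV. card (arcs P s j - E s j)) \<le> (\<Sum>s\<in>UNIV. \<Sum>j\<in>UNIV. card (arcs P s j))"
    by (intro sum_mono card_mono) auto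
  then show ?case by simp
next
  case (generate_columns E x d E' U W \<theta>)
  then show ?case
    using column_generation_decreases[OF generate_columns(4,1,2,3)] by simp
next
  case (add_benders_cuts E x d u \<theta> U W)
  define U' where
    "U' s j = (if \<theta> s j < dual_obj P s j x (u s j) then insert (u s j) (U s j) else U s j)" for s j
  obtain s0 j0 where viol: "\<theta> s0 j0 < dual_obj P s0 j0 x (u s0 j0)"
    using add_benders_cuts(5) by auto
  have "dual_tight P s0 j0 (u s0 j0) \<notin> dual_tight P s0 j0 ` U s0 j0"
    using add_benders_cuts(3,6) viol by (intro violated_cut_new_tight) auto
  then have "card (- dual_tight P s0 j0 ` U' s0 j0) < card (- dual_tight P s0 j0 ` U s0 j0)"
    using viol by (intro psubset_card_mono) (auto simp: U'_def)
  moreover have "card (- dual_tight P s j ` U' s j) \<le> card (- dual_tight P s j ` U s j)" for s j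
    by (intro card_mono) (auto simp: U'_def)
  ultimately have "cuts_left U' W < cuts_left U W"
    unfolding cuts_left_def
    using double_sum_strict_mono[of "\<lambda>s j. card (- dual_tight P s j ` U' s j)"
        "\<lambda>s j. card (- dual_tight P s j ` U s j)" s0 j0] by simp
  then show ?case by (simp add: U'_def[abs_def])
next
  case (benders_converged E x d u \<theta> U W)
  then show ?case by simp
next
  case (gap_closed x y \<theta> U W)
  then show ?case by auto
next
  case (add_L_shaped_cuts x \<theta> U W)
  then have opt: "master_optimal P \<Phi> U W (x, \<theta>)" by simp
  have "x \<notin> set W"
    using gap_at_visited_nonpos[OF opt] add_L_shaped_cuts(1) \<epsilon> by auto
  then have "card (first_stage P - set (W @ [x])) < card (first_stage P - set W)"
    using finite_first_stage master_optimal_first_stage[OF opt] by (intro psubset_card_mono) auto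
  then show ?case by (simp add: cuts_left_def)
qed

lemma run_invariant_reachable:
  "(dd_ils_step P \<Phi> \<epsilon>)\<^sup>*\<^sup>* st st' \<Longrightarrow> run_invariant \<epsilon> st \<Longrightarrow> run_invariant \<epsilon> st'"
  by (induction rule: rtranclp_induct) (auto intro: run_invariant_step)

lemma no_infinite_run:
  assumes "\<epsilon> > 0" "run_invariant \<epsilon> (\<sigma> 0)" "\<And>i. dd_ils_step P \<Phi> \<epsilon> (\<sigma> i) (\<sigma> (Suc i))"
  shows False
proof -
  have "run_invariant \<epsilon> (\<sigma> i)" for i
    by (induction i) (use assms run_invariant_step in blast)+
  then have "(\<sigma> (Suc i), \<sigma> i) \<in> measures [state_cuts_left, stage_rank]" for i
    using step_decreases[OF assms(3) _ assms(1)] by blast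
  then show False
    using wf_measures[of "[state_cuts_left, stage_rank]"] unfolding wf_iff_no_infinite_down_chain
    by blast
qed

text \<open>
  The common part of both claims: it remains to see that \<open>opt\<close> accepts every solution with cost less
  than \<open>\<epsilon>\<close> above that of every feasible first-stage solution.
\<close>

lemma converges_if_near_optimal_accepted:
  assumes \<epsilon>: "\<epsilon> > 0"
    and accept: "\<And>x y. x \<in> first_stage P \<Longrightarrow> (\<And>s j. second_stage_optimal P s j x (y s j)) \<Longrightarrow>
      (\<And>x'. x' \<in> first_stage P \<Longrightarrow> objective x < objective x' + \<epsilon>) \<Longrightarrow> opt (x, y)"
  shows "dd_ils_converges P \<Phi> \<epsilon> (ends_with P opt)"
  unfolding dd_ils_converges_def
proof (intro allI impI conjI)
  fix st0 assume "dd_ils_initial P \<Phi> st0"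
  then have inv0: "run_invariant \<epsilon> st0" by (rule run_invariant_initial)
  show "\<not> (\<exists>\<sigma>. \<sigma> 0 = st0 \<and> (\<forall>i. dd_ils_step P \<Phi> \<epsilon> (\<sigma> i) (\<sigma> (Suc i))))"
    using no_infinite_run[OF \<epsilon>] inv0 by blast
  fix st assume st: "(dd_ils_step P \<Phi> \<epsilon>)\<^sup>*\<^sup>* st0 st \<and> (\<nexists>st'. dd_ils_step P \<Phi> \<epsilon> st st')"
  have inv: "run_invariant \<epsilon> st" using run_invariant_reachable st inv0 by blast
  then consider "st = Infeasible" | x y where "st = Returned x y"
    using run_continues st by blast
  then show "ends_with P opt st"
  proof cases
    case 1
    then show ?thesis using inv by (simp add: ends_with_def problem_feasible_empty_iff)
  next
    case 2
    then have "opt (x, y)" "first_stage P \<noteq> {}" using inv by (auto intro: accept)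
    then show ?thesis using 2 by (simp add: ends_with_def problem_feasible_empty_iff)
  qed
qed

lemma returned_feasible:
  assumes "x \<in> first_stage P" "\<And>s j. second_stage_optimal P s j x (y s j)"
  shows "(x, y) \<in> problem_feasible P"
  using assms by (auto simp: problem_feasible_def second_stage_optimal_def)

lemma converges_within:
  assumes "\<epsilon> > 0"
  shows "dd_ils_converges P \<Phi> \<epsilon> (ends_with P (within_of_optimum P \<epsilon>))"
proof (rule converges_if_near_optimal_accepted[OF assms])
  fix x y assume x: "x \<in> first_stage P" and y: "\<And>s j. second_stage_optimal P s j x (y s j)"
    and near: "\<And>x'. x' \<in> first_stage P \<Longrightarrow> objective x < objective x' + \<epsilon>"
  have "problem_cost P (x, y) \<le> problem_cost P z' + \<epsilon>" if z': "z' \<in> problem_feasible P" for z'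
  proof -
    obtain x' y' where eq: "z' = (x', y')" by (cases z')
    then have "x' \<in> first_stage P" using z' by (simp add: problem_feasible_def)
    then show ?thesis
      using near[of x'] objective_le_problem_cost[of x' y'] z' problem_cost_eq_objective[OF y]
      unfolding eq by simp
  qed
  then show "within_of_optimum P \<epsilon> (x, y)"
    using returned_feasible[OF x y] by (simp add: within_of_optimum_def)
qed

text \<open>
  There are finitely many first-stage solutions, so a tolerance below every positive difference of
  their costs only accepts optimal ones.
\<close>

lemma ex_separating_tolerance:
  "\<exists>\<epsilon>0>0. \<forall>x\<in>first_stage P. \<forall>x'\<in>first_stage P.
     objective x' < objective x \<longrightarrow> objective x' + \<epsilon>0 \<le> objective x"
proof -
  define D where "D = (\<lambda>(x, x'). objective x - objective x') ` (first_stage P \<times> first_stage P) \<inter> {0<..}"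
  have fin: "finite D" using finite_first_stage by (simp add: D_def)
  \<comment> \<open>The element 1 covers the case that there is no positive difference.\<close>
  define \<epsilon>0 where "\<epsilon>0 = Min (insert 1 D)"
  have "\<epsilon>0 > 0" unfolding \<epsilon>0_def using fin by (subst Min_gr_iff) (auto simp: D_def)
  moreover have "objective x' + \<epsilon>0 \<le> objective x"
    if "x \<in> first_stage P" "x' \<in> first_stage P" "objective x' < objective x" for x x'
  proof -
    have "objective x - objective x' \<in> D" using that by (force simp: D_def)
    then have "\<epsilon>0 \<le> objective x - objective x'" unfolding \<epsilon>0_def using fin by (intro Min_le) auto
    then show ?thesis by simp
  qed
  ultimately show ?thesis by blast
qed

lemma converges_optimal:
  "\<exists>\<epsilon>0>0. \<forall>\<epsilon>. 0 < \<epsilon> \<and> \<epsilon> < \<epsilon>0 \<longrightarrow>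
     dd_ils_converges P \<Phi> \<epsilon> (ends_with P (problem_optimal P))"
proof -
  obtain \<epsilon>0 where \<epsilon>0: "\<epsilon>0 > 0"
    "\<And>x x'. x \<in> first_stage P \<Longrightarrow> x' \<in> first_stage P \<Longrightarrow> objective x' < objective x \<Longrightarrow>
       objective x' + \<epsilon>0 \<le> objective x"
    using ex_separating_tolerance by blast
  have "dd_ils_converges P \<Phi> \<epsilon> (ends_with P (problem_optimal P))" if \<epsilon>: "0 < \<epsilon>" "\<epsilon> < \<epsilon>0" for \<epsilon>
  proof (rule converges_if_near_optimal_accepted[OF \<epsilon>(1)])
    fix x y assume x: "x \<in> first_stage P" and y: "\<And>s j. second_stage_optimal P s j x (y s j)"
      and near: "\<And>x'. x' \<in> first_stage P \<Longrightarrow> objective x < objective x' + \<epsilon>"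
    have "problem_cost P (x, y) \<le> problem_cost P z'" if z': "z' \<in> problem_feasible P" for z'
    proof -
      obtain x' y' where eq: "z' = (x', y')" by (cases z')
      then have x': "x' \<in> first_stage P" using z' by (simp add: problem_feasible_def)
      have "objective x \<le> objective x'"
        using near[OF x'] \<epsilon>0(2)[OF x x'] \<epsilon>(2) by linarith
      then show ?thesis
        using objective_le_problem_cost[of x' y'] z' problem_cost_eq_objective[OF y]
        unfolding eq by simp
    qed
    then show "problem_optimal P (x, y)"
      using returned_feasible[OF x y] by (simp add: problem_optimal_def)
  qed
  then show ?thesis using \<epsilon>0(1) by blast
qed

end

theorem theorem2:
  fixes P :: "('s::finite, 'j::finite, 'k::finite, 'r::finite, 'n::finite, 'q::finite) two_stage"
    and \<Phi> :: "'s \<Rightarrow> 'j \<Rightarrow> real"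
  assumes "valid_data P"
    and "X_MIO P = {x. \<forall>k. x $ k \<in> {0, 1}}"
    and "relatively_complete_recourse P"
    and "second_stage_attained P"
    and "global_lower_bound P \<Phi>"
    and "\<And>s j. dual_set P s j (arcs P s j) \<noteq> {}"
  shows "(\<exists>\<epsilon>0>0. \<forall>\<epsilon>. 0 < \<epsilon> \<and> \<epsilon> < \<epsilon>0 \<longrightarrow>
            dd_ils_converges P \<Phi> \<epsilon> (ends_with P (problem_optimal P))) \<and>
         (\<forall>\<epsilon>>0. dd_ils_converges P \<Phi> \<epsilon> (ends_with P (within_of_optimum P \<epsilon>)))"
proof -
  interpret binary_recourse_problem P \<Phi>
    using assms by unfold_locales
  show ?thesis using converges_optimal converges_within by blast
qed

end
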